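(* Let $X\subset\mathbb{R}$ be a compact interval and let $Z=Z_-\cup Z_+$ be the union of two intervals $Z_-=[\underline{z_-},\overline{z_-}]$ and $Z_+=[\underline{z_+},\overline{z_+}]$. Let $\sigma_X\in\mathcal{P}(X)$, $\sigma_Z\in\mathcal{P}(Z)$, $y=\int_Z z\,d\sigma_Z(z)$, and assume $\overline{z_-}<y<\underline{z_+}$. Assume furthermore that $\sigma_X$ is non-atomic and that the continuous function $c:X\times Z\to\mathbb{R}$ satisfies the martingale Spence–Mirrlees condition. Then there exists a unique solution $\pi\in\Pi^{\mathrm{Bar}}(F,\sigma_X,\sigma_Z)$ to $$\min_{\pi\in\Pi^{\mathrm{Bar}}(F,\sigma_X,\sigma_Z)}\int c(x,z)\,d\pi(x,z),$$ where $F$ is the constant function $F(x)=y$.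
   Context: $\mathcal{P}(X)$ is the set of Borel probability measures on $X$; $\Pi(\sigma_X,\sigma_Z)$ is the set of couplings of $\sigma_X$ and $\sigma_Z$. $\sigma_X\otimes\kappa$ denotes the joint measure with first marginal $\sigma_X$ and conditional probability kernel $\kappa$. For $F:X\to\mathbb{R}$, $\Pi^{\mathrm{Bar}}(F,\sigma_X,\sigma_Z)$ is the set of $\pi=\sigma_X\otimes\kappa_X^Z\in\Pi(\sigma_X,\sigma_Z)$ with $\int z\,\kappa_X^Z(x,dz)=F(x)$ for $\sigma_X$-a.e. $x$. Martingale Spence–Mirrlees condition: $\partial_x c(x,z)$ is strictly concave in $z$ for each $x$, or, more generally, $z\mapsto c(x',z)-c(x,z)$ is strictly concave on $Z$ for each $x<x'$ in $X$. Strict concavity of $g$ on $Z$ means $g((1-\lambda)z^-+\lambda z^+)>(1-\lambda)g(z^-)+\lambda g(z^+)$ whenever $z^-<z^+$, $\lambda\in(0,1)$ and $z^-,z^+,(1-\lambda)z^-+\lambda z^+\in Z$. *)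

theory Defs
  imports "HOL-Probability.Probability"
begin

text \<open>Borel probability measures on a subset \<open>X\<close>. The carrier of such a measure is
  \<open>X\<close> itself, not the ambient space.\<close>

definition borel_probs :: "'a::topological_space set \<Rightarrow> 'a measure set" where
  "borel_probs X = {\<mu>. sets \<mu> = sets (restrict_space borel X) \<and> prob_space \<mu>}"

text \<open>Atoms are taken in the measure-theoretic sense, as measurable sets of positive measure
  that cannot be split.\<close>

definition non_atomic :: "'a measure \<Rightarrow> bool" where
  "non_atomic M \<longleftrightarrow> (\<forall>A\<in>sets M. 0 < emeasure M A \<longrightarrow>
     (\<exists>B\<in>sets M. B \<subseteq> A \<and> 0 < emeasure M B \<and> emeasure M B < emeasure M A))"

definition couplings :: "'a measure \<Rightarrow> 'b measure \<Rightarrow> ('a \<times> 'b) measure set" where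
  "couplings M N = {\<pi>. sets \<pi> = sets (M \<Otimes>\<^sub>M N) \<and> prob_space \<pi> \<and>
     distr \<pi> M fst = M \<and> distr \<pi> N snd = N}"

text \<open>The joint measure \<open>M \<otimes> \<kappa>\<close>. Of \<open>N\<close> only the sigma-algebra matters. For a Markov
  kernel \<open>\<kappa>\<close> from \<open>M\<close> to \<open>N\<close>, the measure of \<open>A\<close> is
  \<open>\<integral> \<kappa> x {z. (x, z) \<in> A} \<partial>M\<close>.\<close>

definition kernel_prod ::
    "'a measure \<Rightarrow> 'b measure \<Rightarrow> ('a \<Rightarrow> 'b measure) \<Rightarrow> ('a \<times> 'b) measure" where
  "kernel_prod M N \<kappa> = M \<bind> (\<lambda>x. distr (\<kappa> x) (M \<Otimes>\<^sub>M N) (Pair x))"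

definition bar_couplings ::
    "('a \<Rightarrow> real) \<Rightarrow> 'a measure \<Rightarrow> real measure \<Rightarrow> ('a \<times> real) measure set" where
  "bar_couplings F M N = {\<pi> \<in> couplings M N.
     \<exists>\<kappa> \<in> M \<rightarrow>\<^sub>M prob_algebra N. \<pi> = kernel_prod M N \<kappa> \<and>
       (AE x in M. (\<integral>z. z \<partial>\<kappa> x) = F x)}"

text \<open>\<open>Z\<close> need not be convex: only intermediate points that lie in \<open>Z\<close> are constrained.\<close>

definition strictly_concave_on :: "real set \<Rightarrow> (real \<Rightarrow> real) \<Rightarrow> bool" where
  "strictly_concave_on Z g \<longleftrightarrow>
     (\<forall>z1\<in>Z. \<forall>z2\<in>Z. \<forall>t. z1 < z2 \<longrightarrow> 0 < t \<longrightarrow> t < 1 \<longrightarrow> (1 - t) * z1 + t * z2 \<in> Z \<longrightarrow>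
        g ((1 - t) * z1 + t * z2) > (1 - t) * g z1 + t * g z2)"

text \<open>The general form of the condition, which makes sense without differentiability of \<open>c\<close>.
  It covers the case where the partial derivative of \<open>c\<close> in the first variable is strictly
  concave in the second.\<close>

definition martingale_spence_mirrlees ::
    "real set \<Rightarrow> real set \<Rightarrow> (real \<Rightarrow> real \<Rightarrow> real) \<Rightarrow> bool" where
  "martingale_spence_mirrlees X Z c \<longleftrightarrow>
     (\<forall>x\<in>X. \<forall>x'\<in>X. x < x' \<longrightarrow> strictly_concave_on Z (\<lambda>z. c x' z - c x z))"

end

theory Submission imports Defs begin

text \<open>The minimiser \<open>\<rho>\<close> sends \<open>x\<close> to two points \<open>Tm x < y < Tp x\<close>, with \<open>Tm\<close> decreasing and
  \<open>Tp\<close> increasing: small \<open>x\<close> use the part of \<open>\<sigma>\<^sub>Z\<close> nearest to \<open>y\<close>. It is explicit because the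
  moment measures \<open>(z - y)\<^sup>+ d\<sigma>\<^sub>Z\<close> and \<open>(z - y)\<^sup>- d\<sigma>\<^sub>Z\<close> have equal mass and must be consumed at the
  same rate.

  For a plan \<open>\<pi>\<close> and a concave \<open>\<phi>\<close>, the law of \<open>z\<close> on \<open>{x \<ge> t}\<close> satisfies
  \<open>\<integral>\<^bsub>{x \<ge> t}\<^esub> \<phi>(z) d\<pi> \<ge> \<integral>\<^bsub>{x \<ge> t}\<^esub> \<phi>(z) d\<rho>\<close>: subtract from \<open>\<phi>\<close> its chord over \<open>[Tm t, Tp t]\<close>, whose
  integral is fixed by the barycentre condition; the rest is nonnegative exactly between these
  points. Summation by parts in \<open>x\<close>, with \<open>\<phi> = c(x', \<cdot>) - c(x, \<cdot>)\<close>, turns this into optimality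
  of \<open>\<rho>\<close> for \<open>c\<close>. If \<open>\<pi>\<close> is optimal too, strict concavity forces \<open>z \<in> [Tm t, Tp t]\<close> for \<open>x < t\<close> and
  \<open>z \<notin> (Tm t, Tp t)\<close> for \<open>x > t\<close>; the law of \<open>z\<close> on \<open>{x \<ge> t}\<close> is then known off the two points
  \<open>Tm t, Tp t\<close>, and mass and mean determine the two remaining weights.\<close>

subsection \<open>Monotone transport\<close>

text \<open>The distribution function of an atomless law carries that law to the uniform one. By
  continuity the sublevel set is empty, the whole line, or a closed ray \<open>{..Sup}\<close>; in
  the last case the intermediate value theorem shows that the value at the endpoint is exactly
  \<open>q\<close>.\<close>

lemma (in real_distribution) measure_cdf_le:
  assumes atomless: "\<And>x. measure M {x} = 0" and q: "0 \<le> q" "q \<le> 1"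
  shows "measure M {x. cdf M x \<le> q} = q"
proof -
  have cont: "continuous_on A (cdf M)" for A
    by (rule continuous_at_imp_continuous_on) (simp add: isCont_cdf atomless)
  consider "q = 1" | "q < 1" "\<forall>x. q < cdf M x" | x0 where "q < 1" "cdf M x0 \<le> q"
    using q by (meson not_le order_le_less)
  then show ?thesis
  proof cases
    case 1
    then show ?thesis
      using prob_space by (simp add: cdf_bounded_prob)
  next
    case 2
    have "q \<le> 0"
      using 2(2) by (intro tendsto_lowerbound[OF cdf_lim_at_bot]) (auto intro!: always_eventually less_imp_le)
    moreover have "{x. cdf M x \<le> q} = {}"
      using 2(2) by (auto simp: not_le)
    ultimately show ?thesis using q by simp
  next
    case 3
    have "\<forall>\<^sub>F x in at_top. q < cdf M x"
      using order_tendstoD(1)[OF cdf_lim_at_top_prob] 3 by auto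
    then obtain x1 where x1: "q < cdf M x1"
      by (auto simp: eventually_at_top_linorder)
    have "x0 \<le> x1"
      using cdf_nondecreasing[of x1 x0] x1 3 by linarith
    let ?A = "{x. cdf M x \<le> q}"
    have bdd: "bdd_above ?A"
    proof (rule bdd_aboveI[of _ x1])
      fix x assume "x \<in> ?A"
      then show "x \<le> x1"
        using cdf_nondecreasing[of x1 x] x1 by (cases "x1 \<le> x") auto
    qed
    have cl: "closed ?A"
      by (intro closed_Collect_le cont continuous_on_const)
    have sup: "Sup ?A \<in> ?A"
      using 3 bdd cl by (intro closed_contains_Sup) auto
    have A: "?A = {..Sup ?A}"
    proof safe
      fix x assume "cdf M x \<le> q"
      then show "x \<le> Sup ?A" using bdd by (intro cSup_upper) auto
    next
      fix x assume "x \<le> Sup ?A"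
      then show "cdf M x \<le> q" using sup cdf_nondecreasing[of x "Sup ?A"] by simp
    qed
    obtain z where z: "x0 \<le> z" "cdf M z = q"
      using IVT'[of "cdf M" x0 q x1] x1 3 \<open>x0 \<le> x1\<close> cont by auto
    then have "z \<le> Sup ?A" using A by blast
    then have "q \<le> cdf M (Sup ?A)"
      using cdf_nondecreasing z by blast
    with sup have "cdf M (Sup ?A) = q" by simp
    then show ?thesis
      by (subst A) (simp add: cdf_def)
  qed
qed

text \<open>The map \<open>S\<close> is the quantile function of \<open>P\<close> composed with the distribution function of \<open>M\<close>.\<close>

lemma monotone_transport:
  fixes l u :: real
  assumes M: "real_distribution M" and atomless: "\<And>x. measure M {x} = 0"
    and P: "real_distribution P" and conc: "AE x in P. l \<le> x \<and> x \<le> u"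
  obtains S where "mono S" "\<And>x. l \<le> S x" "\<And>x. S x \<le> u" "distr M borel S = P"
proof -
  interpret M: real_distribution M by fact
  interpret P: real_distribution P by fact
  let ?F = "cdf M" and ?C = "cdf P"
  have C1: "?C x = 1" if "u \<le> x" for x
    unfolding cdf_def using conc that by (intro P.prob_eq_1[THEN iffD2]) auto
  have C0: "?C x = 0" if "x < l" for x
    unfolding cdf_def using conc that by (intro P.prob_eq_0[THEN iffD2]) auto
  have "l \<le> u"
    using P.AE_contr conc by (metis (mono_tags, lifting) AE_mp AE_I2 order_trans)
  \<comment> \<open>The infimum is taken inside \<open>{l..u}\<close>, so \<open>S\<close> stays in
    \<open>[l, u]\<close> at every point and not merely almost everywhere; \<open>u\<close> itself
    always qualifies.\<close>
  define Q where "Q v = {s\<in>{l..u}. ?F v \<le> ?C s}" for v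
  define S where "S v = Inf (Q v)" for v
  have uQ: "u \<in> Q v" for v
    using C1[of u] M.cdf_bounded_prob \<open>l \<le> u\<close> by (auto simp: Q_def)
  have bdd: "bdd_below (Q v)" for v
    by (rule bdd_belowI[of _ l]) (auto simp: Q_def)
  have mono: "mono S"
  proof (rule monoI)
    fix v w :: real assume "v \<le> w"
    then have "Q w \<subseteq> Q v"
      using M.cdf_nondecreasing[of v w] by (auto simp: Q_def)
    then show "S v \<le> S w"
      unfolding S_def using uQ bdd by (intro cInf_superset_mono) auto
  qed
  have l: "l \<le> S v" for v
    unfolding S_def using uQ by (intro cInf_greatest) (auto simp: Q_def)
  have u: "S v \<le> u" for v
    unfolding S_def using uQ bdd by (rule cInf_lower)
  \<comment> \<open>Right continuity of \<open>?C\<close> yields this adjunction. It turns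
    \<open>S v \<le> x\<close> into a sublevel condition on \<open>?F\<close>, to which
    \<open>measure_cdf_le\<close> applies.\<close>
  have galois: "S v \<le> x \<longleftrightarrow> ?F v \<le> ?C x" if x: "l \<le> x" "x \<le> u" for v x
  proof
    assume "?F v \<le> ?C x"
    then show "S v \<le> x"
      unfolding S_def using x bdd by (intro cInf_lower) (auto simp: Q_def)
  next
    assume le: "S v \<le> x"
    have "\<forall>\<^sub>F s in at_right x. ?F v \<le> ?C s"
    proof (rule eventually_at_rightI[of x "x + 1"])
      fix s assume "s \<in> {x<..<x + 1}"
      then have "Inf (Q v) < s" using le by (simp add: S_def)
      then obtain s' where "s' \<in> Q v" "s' < s"
        using uQ by (metis cInf_lessD empty_iff)
      then show "?F v \<le> ?C s"
        using P.cdf_nondecreasing[of s' s] by (auto simp: Q_def)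
    qed simp
    moreover have "(?C \<longlongrightarrow> ?C x) (at_right x)"
      using P.cdf_is_right_cont by (simp add: continuous_within)
    ultimately show "?F v \<le> ?C x"
      by (intro tendsto_lowerbound) auto
  qed
  have [measurable]: "S \<in> borel_measurable borel"
    using mono by (rule borel_measurable_mono)
  have "distr M borel S = P"
  proof (rule cdf_unique[OF _ P])
    show "real_distribution (distr M borel S)" by simp
    show "cdf (distr M borel S) = ?C"
    proof
      fix x
      have eq: "cdf (distr M borel S) x = measure M {v. S v \<le> x}"
        by (simp add: cdf_def measure_distr vimage_def)
      consider "x < l" | "l \<le> x" "x \<le> u" | "u < x" by linarith
      then show "cdf (distr M borel S) x = ?C x"
      proof cases
        case 1
        then have "{v. S v \<le> x} = {}" using l by (auto simp: not_le intro: less_le_trans)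
        then show ?thesis using 1 C0 eq by simp
      next
        case 2
        then show ?thesis
          unfolding eq galois[OF 2] using P.cdf_nonneg P.cdf_bounded_prob
          by (intro M.measure_cdf_le atomless) auto
      next
        case 3
        then have "{v. S v \<le> x} = UNIV" using u by (force intro: order_trans)
        then show ?thesis using 3 C1 eq M.prob_space by simp
      qed
    qed
  qed
  with mono l u show ?thesis by (rule that)
qed

text \<open>The normalised moment measures on the two sides of \<open>y\<close> are both run as
  quantile functions of one uniform clock \<open>s\<close>. Points met at the same time carry equal
  moments, which is why \<open>N\<close> is reproduced by the weights in the last conclusion, the
  only ones for which two atoms at \<open>Tm x\<close> and \<open>Tp x\<close> have mean
  \<open>y\<close>. Measuring the clock by consumed mass then lets \<open>x\<close> with law
  \<open>M\<close> run through it.\<close>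

lemma martingale_transport_pair:
  fixes M N :: "real measure" and zml zmu zpl zpu y :: real
  assumes M: "real_distribution M" and atomless: "\<And>x. measure M {x} = 0"
    and N: "real_distribution N"
    and supp: "AE z in N. zml \<le> z \<and> z \<le> zmu \<or> zpl \<le> z \<and> z \<le> zpu"
    and y: "y = (\<integral>z. z \<partial>N)" "zmu < y" "y < zpl"
  obtains Tm Tp :: "real \<Rightarrow> real"
  where "antimono Tm" "mono Tp"
    and "\<And>x. zml \<le> Tm x \<and> Tm x \<le> zmu" "\<And>x. zpl \<le> Tp x \<and> Tp x \<le> zpu"
    and "\<And>B. B \<in> sets borel \<Longrightarrow> emeasure N B =
      (\<integral>\<^sup>+x. ennreal ((Tp x - y) / (Tp x - Tm x)) * indicator B (Tm x)
          + ennreal ((y - Tm x) / (Tp x - Tm x)) * indicator B (Tp x) \<partial>M)"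
proof -
  interpret M: real_distribution M by fact
  interpret N: real_distribution N by fact
  define fp where "fp z = max 0 (z - y)" for z :: real
  define fm where "fm z = max 0 (y - z)" for z :: real
  have [measurable]: "fp \<in> borel_measurable borel" "fm \<in> borel_measurable borel"
    by (auto simp: fp_def[abs_def] fm_def[abs_def])
  have nonneg: "0 \<le> fp z" "0 \<le> fm z" for z
    by (auto simp: fp_def fm_def)
  define K where "K = \<bar>zml\<bar> + \<bar>zmu\<bar> + \<bar>zpl\<bar> + \<bar>zpu\<bar> + \<bar>y\<bar>"
  have int: "integrable N (\<lambda>z. z)" "integrable N fp" "integrable N fm"
    using supp by (auto intro!: N.integrable_const_bound[where B=K] elim!: eventually_mono
      simp: fp_def fm_def K_def)
  define m where "m = (\<integral>z. fp z \<partial>N)"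
  \<comment> \<open>Since \<open>y\<close> is the mean of \<open>N\<close>, the moments on its two
    sides balance at the common value \<open>m\<close>.\<close>
  have "(\<integral>z. fp z \<partial>N) - (\<integral>z. fm z \<partial>N) = (\<integral>z. fp z - fm z \<partial>N)"
    using int by simp
  also have "\<dots> = (\<integral>z. z - y \<partial>N)"
    by (intro Bochner_Integration.integral_cong) (auto simp: fp_def fm_def)
  also have "\<dots> = 0"
    using int y(1) N.prob_space by simp
  finally have m_eq: "m = (\<integral>z. fm z \<partial>N)" by (simp add: m_def)
  \<comment> \<open>A lower bound for the distance from \<open>y\<close> to the support; it makes
    \<open>m\<close> positive, so that the moment measures can be normalised.\<close>
  define d where "d = min (y - zmu) (zpl - y)"
  have "0 < d" using y by (auto simp: d_def)
  have "d = (\<integral>z. d \<partial>N)" using N.prob_space by simp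
  also have "\<dots> \<le> (\<integral>z. fp z + fm z \<partial>N)"
    using supp int by (intro integral_mono_AE) (auto elim!: eventually_mono simp: fp_def fm_def d_def)
  also have "\<dots> = 2 * m" using int m_eq by (simp add: m_def)
  finally have m: "0 < m" using \<open>0 < d\<close> by simp
  define Dp where "Dp = density N (\<lambda>z. ennreal (fp z / m))"
  define Dm where "Dm = density N (\<lambda>z. ennreal (fm z / m))"
  have sDp[measurable_cong]: "sets Dp = sets borel" "space Dp = UNIV" by (auto simp: Dp_def)
  have sDm[measurable_cong]: "sets Dm = sets borel" "space Dm = UNIV" by (auto simp: Dm_def)
  have "prob_space Dp"
  proof
    have "emeasure Dp (space Dp) = (\<integral>\<^sup>+z. ennreal (fp z / m) \<partial>N)"
      by (simp add: Dp_def emeasure_density cong: nn_integral_cong)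
    also have "\<dots> = ennreal (\<integral>z. fp z / m \<partial>N)"
      using int nonneg m by (intro nn_integral_eq_integral) auto
    finally show "emeasure Dp (space Dp) = 1"
      using m by (simp add: m_def)
  qed
  then have Dp: "real_distribution Dp"
    by (simp add: real_distribution_def real_distribution_axioms_def sDp)
  have "prob_space Dm"
  proof
    have "emeasure Dm (space Dm) = (\<integral>\<^sup>+z. ennreal (fm z / m) \<partial>N)"
      by (simp add: Dm_def emeasure_density cong: nn_integral_cong)
    also have "\<dots> = ennreal (\<integral>z. fm z / m \<partial>N)"
      using int nonneg m by (intro nn_integral_eq_integral) auto
    finally show "emeasure Dm (space Dm) = 1"
      using m m_eq by simp
  qed
  then interpret Dm: prob_space Dm .
  \<comment> \<open>After reflection the increasing quantile function starts at the points nearest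
    to \<open>y\<close>; undoing the reflection later makes \<open>Tm\<close> decreasing.\<close>
  have Dm': "real_distribution (distr Dm borel uminus)"
    by (intro Dm.real_distribution_distr) measurable
  have suppDp: "AE z in Dp. zpl \<le> z \<and> z \<le> zpu"
    unfolding Dp_def using supp y by (subst AE_density) (auto elim!: eventually_mono simp: fp_def)
  have suppDm: "AE z in distr Dm borel uminus. - zmu \<le> z \<and> z \<le> - zml"
    unfolding Dm_def using supp y
    by (subst AE_distr_iff, simp, measurable, subst AE_density) (auto elim!: eventually_mono simp: fm_def)
  define U :: "real measure" where "U = uniform_measure lborel {0..1}"
  have sU[measurable_cong]: "sets U = sets borel" by (simp add: U_def)
  have "prob_space U" unfolding U_def by (intro prob_space_uniform_measure) auto
  then have U: "real_distribution U"
    by (simp add: real_distribution_def real_distribution_axioms_def sU)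
  interpret U: real_distribution U by fact
  have U0: "measure U {x} = 0" for x
  proof -
    have "emeasure U {x} = 0"
      unfolding U_def by (subst emeasure_uniform_measure)
        (auto intro!: emeasure_eq_0[OF _ _ Int_lower2] simp: ennreal_divide_self)
    then show ?thesis by (simp add: measure_def)
  qed
  have U01: "AE s in U. 0 \<le> s \<and> s \<le> 1"
    unfolding U_def by (rule AE_uniform_measureI) auto
  obtain Rp where Rp: "mono Rp" "\<And>x. zpl \<le> Rp x" "\<And>x. Rp x \<le> zpu" "distr U borel Rp = Dp"
    using monotone_transport[OF U U0 Dp suppDp] by metis
  obtain Rm where Rm: "mono Rm" "\<And>x. - zmu \<le> Rm x" "\<And>x. Rm x \<le> - zml"
      "distr U borel Rm = distr Dm borel uminus"
    using monotone_transport[OF U U0 Dm' suppDm] by metis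
  have [measurable]: "Rp \<in> borel_measurable borel" "Rm \<in> borel_measurable borel"
    using Rp(1) Rm(1) by (auto intro: borel_measurable_mono)
  have pos: "0 < Rp s - y" "0 < y + Rm s" for s
    using Rp(2)[of s] Rm(2)[of s] y by auto
  \<comment> \<open>Moment divided by distance from \<open>y\<close> is mass again:
    \<open>m / (z - y)\<close> cancels the density \<open>fp z / m\<close>. The fact
    \<open>minus\<close> is the same on the left.\<close>
  have plus: "(\<integral>\<^sup>+s. ennreal (m / (Rp s - y)) * indicator B (Rp s) \<partial>U) = emeasure N (B \<inter> {y<..})"
    if [measurable]: "B \<in> sets borel" for B
  proof -
    have "(\<integral>\<^sup>+s. ennreal (m / (Rp s - y)) * indicator B (Rp s) \<partial>U)
        = (\<integral>\<^sup>+z. ennreal (m / (z - y)) * indicator B z \<partial>Dp)"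
      unfolding Rp(4)[symmetric] by (subst nn_integral_distr) auto
    also have "\<dots> = (\<integral>\<^sup>+z. ennreal (fp z / m) * (ennreal (m / (z - y)) * indicator B z) \<partial>N)"
      unfolding Dp_def by (subst nn_integral_density) auto
    also have "\<dots> = (\<integral>\<^sup>+z. indicator (B \<inter> {y<..}) z \<partial>N)"
      using m by (intro nn_integral_cong)
        (auto simp: fp_def max_def indicator_def ennreal_mult'[symmetric] field_simps)
    finally show ?thesis by simp
  qed
  have minus: "(\<integral>\<^sup>+s. ennreal (m / (y + Rm s)) * indicator B (- Rm s) \<partial>U) = emeasure N (B \<inter> {..<y})"
    if [measurable]: "B \<in> sets borel" for B
  proof -
    have "(\<integral>\<^sup>+s. ennreal (m / (y + Rm s)) * indicator B (- Rm s) \<partial>U)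
        = (\<integral>\<^sup>+v. ennreal (m / (y + v)) * indicator B (- v) \<partial>distr U borel Rm)"
      by (subst nn_integral_distr) auto
    also have "\<dots> = (\<integral>\<^sup>+z. ennreal (m / (y - z)) * indicator B z \<partial>Dm)"
      unfolding Rm(4) by (subst nn_integral_distr) auto
    also have "\<dots> = (\<integral>\<^sup>+z. ennreal (fm z / m) * (ennreal (m / (y - z)) * indicator B z) \<partial>N)"
      unfolding Dm_def by (subst nn_integral_density) auto
    also have "\<dots> = (\<integral>\<^sup>+z. indicator (B \<inter> {..<y}) z \<partial>N)"
      using m by (intro nn_integral_cong)
        (auto simp: fm_def max_def indicator_def ennreal_mult'[symmetric] field_simps)
    finally show ?thesis by simp
  qed
  have sum: "emeasure N (B \<inter> {..<y}) + emeasure N (B \<inter> {y<..}) = emeasure N B"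
    if [measurable]: "B \<in> sets borel" for B
  proof -
    have "emeasure N (B \<inter> {..<y}) + emeasure N (B \<inter> {y<..}) = emeasure N (B \<inter> {..<y} \<union> B \<inter> {y<..})"
      by (rule plus_emeasure) auto
    also have "\<dots> = emeasure N B"
      using supp y by (intro emeasure_eq_AE) (auto elim!: eventually_mono)
    finally show ?thesis .
  qed
  \<comment> \<open>The mass of \<open>N\<close> consumed per unit of clock time, both sides
    together. Its integral is the mass of \<open>N\<close>, so \<open>P\<close> is a probability
    measure: the law of the clock when time is weighted by mass.\<close>
  define w where "w s = m / (y + Rm s) + m / (Rp s - y)" for s
  have [measurable]: "w \<in> borel_measurable borel" unfolding w_def[abs_def] by measurable
  define P where "P = density U (\<lambda>s. ennreal (w s))"
  have sP[measurable_cong]: "sets P = sets borel" "space P = UNIV" by (auto simp: P_def sU)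
  have "prob_space P"
  proof
    have "emeasure P (space P) = (\<integral>\<^sup>+s. ennreal (w s) \<partial>U)"
      by (simp add: P_def emeasure_density cong: nn_integral_cong)
    also have "\<dots> = (\<integral>\<^sup>+s. ennreal (m / (y + Rm s)) * indicator UNIV (- Rm s)
        + ennreal (m / (Rp s - y)) * indicator UNIV (Rp s) \<partial>U)"
      using pos m by (intro nn_integral_cong) (simp add: w_def ennreal_plus less_imp_le)
    also have "\<dots> = 1"
      using plus[of UNIV] minus[of UNIV] sum[of UNIV] N.emeasure_space_1
      by (subst nn_integral_add) auto
    finally show "emeasure P (space P) = 1" .
  qed
  then have P: "real_distribution P"
    by (simp add: real_distribution_def real_distribution_axioms_def sP)
  have P01: "AE s in P. 0 \<le> s \<and> s \<le> 1"
    unfolding P_def using U01 by (subst AE_density) auto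
  \<comment> \<open>The absence of atoms of \<open>M\<close> enters here: it lets \<open>M\<close>
    be carried onto \<open>P\<close> by a monotone map.\<close>
  obtain S where S: "mono S" "distr M borel S = P"
    using monotone_transport[OF M atomless P P01] by metis
  have [measurable]: "S \<in> borel_measurable borel"
    using S(1) by (rule borel_measurable_mono)
  define Tm where "Tm x = - Rm (S x)" for x
  define Tp where "Tp x = Rp (S x)" for x
  show thesis
  proof (rule that[of Tm Tp])
    show "antimono Tm" using Rm(1) S(1) by (auto simp: antimono_def Tm_def mono_def)
    show "mono Tp" using Rp(1) S(1) by (auto simp: Tp_def mono_def)
    show "zml \<le> Tm x \<and> Tm x \<le> zmu" for x using Rm(2,3)[of "S x"] by (auto simp: Tm_def)
    show "zpl \<le> Tp x \<and> Tp x \<le> zpu" for x using Rp(2,3)[of "S x"] by (auto simp: Tp_def)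
    fix B :: "real set" assume [measurable]: "B \<in> sets borel"
    let ?p = "\<lambda>s. (Rp s - y) / (Rp s + Rm s)" and ?q = "\<lambda>s. (y + Rm s) / (Rp s + Rm s)"
    \<comment> \<open>The mean-preserving weights split the rate \<open>w s\<close> back into its
      left and right summands.\<close>
    have pq: "w s * ?p s = m / (y + Rm s)" "w s * ?q s = m / (Rp s - y)" "0 \<le> w s" for s
    proof -
      have w: "w s = m * (Rp s + Rm s) / ((y + Rm s) * (Rp s - y))"
        using pos[of s] by (simp add: w_def field_simps)
      show "w s * ?p s = m / (y + Rm s)" "w s * ?q s = m / (Rp s - y)"
        unfolding w using pos[of s] by (auto simp: divide_simps)
      show "0 \<le> w s" unfolding w_def using pos[of s] m by simp
    qed
    have "(\<integral>\<^sup>+x. ennreal ((Tp x - y) / (Tp x - Tm x)) * indicator B (Tm x)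
          + ennreal ((y - Tm x) / (Tp x - Tm x)) * indicator B (Tp x) \<partial>M)
        = (\<integral>\<^sup>+s. ennreal (?p s) * indicator B (- Rm s) + ennreal (?q s) * indicator B (Rp s) \<partial>P)"
      unfolding S(2)[symmetric] by (subst nn_integral_distr) (auto simp: Tm_def Tp_def)
    also have "\<dots> = (\<integral>\<^sup>+s. ennreal (w s) * (ennreal (?p s) * indicator B (- Rm s)
        + ennreal (?q s) * indicator B (Rp s)) \<partial>U)"
      unfolding P_def by (subst nn_integral_density) auto
    also have "\<dots> = (\<integral>\<^sup>+s. ennreal (m / (y + Rm s)) * indicator B (- Rm s)
        + ennreal (m / (Rp s - y)) * indicator B (Rp s) \<partial>U)"
      by (intro nn_integral_cong)
        (simp only: distrib_left mult.assoc[symmetric] ennreal_mult'[OF pq(3), symmetric] pq(1,2))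
    also have "\<dots> = emeasure N B"
      using plus[of B] minus[of B] sum[of B] by (subst nn_integral_add) auto
    finally show "emeasure N B =
      (\<integral>\<^sup>+x. ennreal ((Tp x - y) / (Tp x - Tm x)) * indicator B (Tm x)
          + ennreal ((y - Tm x) / (Tp x - Tm x)) * indicator B (Tp x) \<partial>M)" by simp
  qed
qed

subsection \<open>Barycentric plans\<close>

lemma nn_integral_kernel_prod:
  assumes \<kappa>: "\<kappa> \<in> M \<rightarrow>\<^sub>M prob_algebra N" and f[measurable]: "f \<in> borel_measurable (M \<Otimes>\<^sub>M N)"
  shows "(\<integral>\<^sup>+p. f p \<partial>kernel_prod M N \<kappa>) = (\<integral>\<^sup>+x. \<integral>\<^sup>+z. f (x, z) \<partial>\<kappa> x \<partial>M)"
proof -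
  have \<kappa>'[measurable]: "\<kappa> \<in> M \<rightarrow>\<^sub>M subprob_algebra N"
    using \<kappa> by (rule measurable_prob_algebraD)
  have [measurable]: "(\<lambda>x. distr (\<kappa> x) (M \<Otimes>\<^sub>M N) (Pair x)) \<in> M \<rightarrow>\<^sub>M subprob_algebra (M \<Otimes>\<^sub>M N)"
    by (rule measurable_distr2[where M=N]) (auto simp: case_prod_beta)
  have "(\<integral>\<^sup>+z. f z \<partial>distr (\<kappa> x) (M \<Otimes>\<^sub>M N) (Pair x)) = (\<integral>\<^sup>+z. f (x, z) \<partial>\<kappa> x)" if "x \<in> space M" for x
  proof (rule nn_integral_distr)
    have "sets (\<kappa> x) = sets N"
      using \<kappa>' that by (rule sets_kernel)
    then show "Pair x \<in> \<kappa> x \<rightarrow>\<^sub>M M \<Otimes>\<^sub>M N"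
      using that by (simp cong: measurable_cong_sets)
  qed simp
  then show ?thesis
    unfolding kernel_prod_def
    by (subst nn_integral_bind[where B="M \<Otimes>\<^sub>M N"]) (auto intro!: nn_integral_cong)
qed

lemma sets_kernel_prod:
  assumes \<kappa>: "\<kappa> \<in> M \<rightarrow>\<^sub>M prob_algebra N" and "space M \<noteq> {}"
  shows "sets (kernel_prod M N \<kappa>) = sets (M \<Otimes>\<^sub>M N)"
  unfolding kernel_prod_def using assms(2) by (subst sets_bind[where N="M \<Otimes>\<^sub>M N"]) auto

lemma non_atomic_singleton:
  assumes "non_atomic M" "{x} \<in> sets M"
  shows "emeasure M {x} = 0"
proof (rule ccontr)
  assume "emeasure M {x} \<noteq> 0"
  then obtain B where "B \<subseteq> {x}" "0 < emeasure M B" "emeasure M B < emeasure M {x}"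
    using assms unfolding non_atomic_def by (metis not_gr_zero)
  then show False
    by (metis emeasure_empty less_irrefl subset_singletonD)
qed

locale barycentric_problem =
  fixes xl xu zml zmu zpl zpu y :: real and M N :: "real measure"
  assumes M: "M \<in> borel_probs {xl..xu}"
    and N: "N \<in> borel_probs ({zml..zmu} \<union> {zpl..zpu})"
    and y: "zmu < y" "y < zpl" "y = (\<integral>z. z \<partial>N)"
    and non_atomic: "non_atomic M"
begin

abbreviation X where "X \<equiv> {xl..xu}"
abbreviation Z where "Z \<equiv> {zml..zmu} \<union> {zpl..zpu}"
abbreviation plans where "plans \<equiv> bar_couplings (\<lambda>x. y) M N"

lemma sets_M: "sets M = sets (restrict_space borel X)"
  and sets_N: "sets N = sets (restrict_space borel Z)"
  and prob_M: "prob_space M" and prob_N: "prob_space N"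
  using M N by (auto simp: borel_probs_def)

lemma space_M[simp]: "space M = X" and space_N[simp]: "space N = Z"
  using sets_eq_imp_space_eq[OF sets_M] sets_eq_imp_space_eq[OF sets_N]
  by (auto simp: space_restrict_space)

lemma ident_M[measurable]: "(\<lambda>x. x) \<in> borel_measurable M"
  and ident_N[measurable]: "(\<lambda>z. z) \<in> borel_measurable N"
  unfolding measurable_cong_sets[OF sets_M refl] measurable_cong_sets[OF sets_N refl]
  by (auto intro: measurable_restrict_space1)

lemma fst_borel[measurable]: "fst \<in> borel_measurable (M \<Otimes>\<^sub>M N)"
  and snd_borel[measurable]: "snd \<in> borel_measurable (M \<Otimes>\<^sub>M N)"
  using measurable_compose[OF measurable_fst ident_M] measurable_compose[OF measurable_snd ident_N]
  by auto

definition bound where "bound = \<bar>zml\<bar> + \<bar>zmu\<bar> + \<bar>zpl\<bar> + \<bar>zpu\<bar>"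

lemma abs_le_bound: "z \<in> Z \<Longrightarrow> \<bar>z\<bar> \<le> bound"
  by (auto simp: bound_def)

lemma add_bound: "z \<in> Z \<Longrightarrow> 0 \<le> z + bound \<and> z + bound \<le> 2 * bound"
  using abs_le_bound[of z] by linarith

lemma emeasure_singleton_M: "x \<in> X \<Longrightarrow> emeasure M {x} = 0"
  by (rule non_atomic_singleton[OF non_atomic]) (auto simp: sets_M sets_restrict_space_iff)

lemma plan_sets: "\<pi> \<in> plans \<Longrightarrow> sets \<pi> = sets (M \<Otimes>\<^sub>M N)"
  and plan_prob: "\<pi> \<in> plans \<Longrightarrow> prob_space \<pi>"
  and plan_fst: "\<pi> \<in> plans \<Longrightarrow> distr \<pi> M fst = M"
  and plan_snd: "\<pi> \<in> plans \<Longrightarrow> distr \<pi> N snd = N"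
  by (auto simp: bar_couplings_def couplings_def)

lemma plan_space: "\<pi> \<in> plans \<Longrightarrow> space \<pi> = X \<times> Z"
  using sets_eq_imp_space_eq[OF plan_sets] by (simp add: space_pair_measure)

lemma plan_measurable: "\<pi> \<in> plans \<Longrightarrow> f \<in> M \<Otimes>\<^sub>M N \<rightarrow>\<^sub>M L \<Longrightarrow> f \<in> \<pi> \<rightarrow>\<^sub>M L"
  using measurable_cong_sets[OF plan_sets refl] by blast

lemma plan_integral_fst:
  fixes f :: "real \<Rightarrow> real"
  assumes \<pi>: "\<pi> \<in> plans" and [measurable]: "f \<in> borel_measurable M"
  shows "(\<integral>p. f (fst p) \<partial>\<pi>) = (\<integral>x. f x \<partial>M)"
proof -
  have "(\<integral>x. f x \<partial>M) = (\<integral>x. f x \<partial>distr \<pi> M fst)"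
    by (simp only: plan_fst[OF \<pi>])
  also have "\<dots> = (\<integral>p. f (fst p) \<partial>\<pi>)"
    by (rule integral_distr[OF plan_measurable[OF \<pi>]]) measurable
  finally show ?thesis ..
qed

lemma plan_integral_snd:
  fixes f :: "real \<Rightarrow> real"
  assumes \<pi>: "\<pi> \<in> plans" and [measurable]: "f \<in> borel_measurable N"
  shows "(\<integral>p. f (snd p) \<partial>\<pi>) = (\<integral>x. f x \<partial>N)"
proof -
  have "(\<integral>x. f x \<partial>N) = (\<integral>x. f x \<partial>distr \<pi> N snd)"
    by (simp only: plan_snd[OF \<pi>])
  also have "\<dots> = (\<integral>p. f (snd p) \<partial>\<pi>)"
    by (rule integral_distr[OF plan_measurable[OF \<pi>]]) measurable
  finally show ?thesis ..
qed

lemma plan_integrable: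
  fixes f :: "real \<times> real \<Rightarrow> real"
  assumes \<pi>: "\<pi> \<in> plans" and "f \<in> borel_measurable (M \<Otimes>\<^sub>M N)"
    and "\<And>x z. x \<in> X \<Longrightarrow> z \<in> Z \<Longrightarrow> \<bar>f (x, z)\<bar> \<le> C"
  shows "integrable \<pi> f"
proof -
  interpret prob_space \<pi> using \<pi> by (rule plan_prob)
  have "f \<in> borel_measurable \<pi>"
    using \<pi> assms(2) by (rule plan_measurable)
  then show ?thesis
    using assms(3) plan_space[OF \<pi>] by (intro integrable_const_bound[where B=C]) auto
qed

text \<open>Integrating the fibrewise condition over \<open>A\<close> gives a form of it that
  mentions no kernel. The kernel formula concerns nonnegative integrands, so \<open>z\<close> is
  first shifted by \<open>bound\<close> and the shift is removed at the end.\<close>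

lemma plan_barycenter:
  assumes \<pi>: "\<pi> \<in> plans" and A[measurable]: "A \<in> sets M"
  shows "(\<integral>p. indicator A (fst p) * (snd p - y) \<partial>\<pi>) = 0"
proof -
  interpret M: prob_space M by (rule prob_M)
  obtain \<kappa> where \<kappa>: "\<kappa> \<in> M \<rightarrow>\<^sub>M prob_algebra N" "\<pi> = kernel_prod M N \<kappa>"
      "AE x in M. (\<integral>z. z \<partial>\<kappa> x) = y"
    using \<pi> unfolding bar_couplings_def by blast
  have bary: "(\<integral>\<^sup>+z. ennreal (z + bound) \<partial>\<kappa> x) = ennreal ((\<integral>z. z \<partial>\<kappa> x) + bound)" if x: "x \<in> X" for x
  proof -
    have "\<kappa> x \<in> space (prob_algebra N)"
      using measurable_space[OF \<kappa>(1), of x] x by simp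
    then have \<kappa>x: "prob_space (\<kappa> x)" "sets (\<kappa> x) = sets N"
      by (auto simp: space_prob_algebra)
    interpret prob_space "\<kappa> x" by (rule \<kappa>x)
    have sp: "space (\<kappa> x) = Z" using sets_eq_imp_space_eq[OF \<kappa>x(2)] by simp
    have int: "integrable (\<kappa> x) (\<lambda>z. z)"
    proof (rule integrable_const_bound[where B=bound])
      show "AE z in \<kappa> x. norm z \<le> bound"
        unfolding real_norm_def by (rule AE_I2, rule abs_le_bound) (simp only: sp)
      show "(\<lambda>z. z) \<in> borel_measurable (\<kappa> x)"
        using ident_N by (simp only: measurable_cong_sets[OF \<kappa>x(2) refl])
    qed
    have "(\<integral>\<^sup>+z. ennreal (z + bound) \<partial>\<kappa> x) = ennreal (\<integral>z. z + bound \<partial>\<kappa> x)"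
      using int add_bound sp by (intro nn_integral_eq_integral AE_I2) auto
    also have "(\<integral>z. z + bound \<partial>\<kappa> x) = (\<integral>z. z \<partial>\<kappa> x) + bound"
      using int prob_space by simp
    finally show ?thesis .
  qed
  have nonneg: "0 \<le> y + bound" "0 \<le> bound"
    using y by (auto simp: bound_def)
  have int1: "integrable \<pi> (\<lambda>p. indicator A (fst p) * (snd p + bound))"
  proof (rule plan_integrable[OF \<pi>, where C="2 * bound"])
    fix x z assume "z \<in> Z"
    then show "\<bar>indicator A (fst (x, z)) * (snd (x, z) + bound)\<bar> \<le> 2 * bound"
      using add_bound[of z] nonneg by (auto simp: indicator_def)
  qed measurable
  have int2: "integrable \<pi> (\<lambda>p. indicator A (fst p) :: real)"
    by (intro plan_integrable[OF \<pi>, where C=1]) (auto simp: indicator_def)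
  have intA: "integrable M (indicator A :: real \<Rightarrow> real)"
    by (intro M.integrable_const_bound[where B=1]) auto
  have pos: "0 \<le> indicator A (fst p) * (snd p + bound)" if "p \<in> space \<pi>" for p
    using that plan_space[OF \<pi>] add_bound[of "snd p"] by (auto intro!: mult_nonneg_nonneg)
  have "ennreal (\<integral>p. indicator A (fst p) * (snd p + bound) \<partial>\<pi>)
      = (\<integral>\<^sup>+p. ennreal (indicator A (fst p) * (snd p + bound)) \<partial>\<pi>)"
    using int1 pos by (intro nn_integral_eq_integral[symmetric] AE_I2)
  also have "\<dots> = (\<integral>\<^sup>+x. \<integral>\<^sup>+z. ennreal (indicator A x * (z + bound)) \<partial>\<kappa> x \<partial>M)"
    unfolding \<kappa>(2) by (subst nn_integral_kernel_prod[OF \<kappa>(1)]) auto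
  also have "\<dots> = (\<integral>\<^sup>+x. ennreal (indicator A x * (y + bound)) \<partial>M)"
  proof (intro nn_integral_cong_AE)
    show "AE x in M. (\<integral>\<^sup>+z. ennreal (indicator A x * (z + bound)) \<partial>\<kappa> x) = ennreal (indicator A x * (y + bound))"
      using \<kappa>(3)
    proof (eventually_elim, goal_cases)
      case (1 x)
      then show ?case using bary[of x] by (cases "x \<in> A") (use sets.sets_into_space[OF A] in auto)
    qed
  qed
  also have "\<dots> = ennreal (\<integral>x. indicator A x * (y + bound) \<partial>M)"
    using nonneg intA by (intro nn_integral_eq_integral) auto
  also have "(\<integral>x. indicator A x * (y + bound) \<partial>M) = (y + bound) * (\<integral>x. indicator A x \<partial>M)"
    by simp
  also have "(\<integral>x. indicator A x \<partial>M :: real) = (\<integral>p. indicator A (fst p) \<partial>\<pi>)"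
    by (rule plan_integral_fst[OF \<pi>, symmetric]) measurable
  finally have eq: "(\<integral>p. indicator A (fst p) * (snd p + bound) \<partial>\<pi>) = (y + bound) * (\<integral>p. indicator A (fst p) \<partial>\<pi>)"
    using nonneg Bochner_Integration.integral_nonneg[OF pos]
    by (subst (asm) ennreal_inj) (auto intro!: mult_nonneg_nonneg)
  have "(\<integral>p. indicator A (fst p) * (snd p - y) \<partial>\<pi>)
      = (\<integral>p. indicator A (fst p) * (snd p + bound) - (y + bound) * indicator A (fst p) \<partial>\<pi>)"
    by (intro Bochner_Integration.integral_cong) (auto simp: algebra_simps)
  also have "\<dots> = 0"
    using int1 int2 eq by simp
  finally show ?thesis .
qed

end

section \<open>Existence of a plan carried by two monotone graphs\<close>

context barycentric_problem
begin

text \<open>The plan mixes the graphs of \<open>Tm\<close> and \<open>Tp\<close> with the weights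
  that give mean \<open>y\<close>. The first marginal is right because the weights sum to one, the
  second by the formula for \<open>N\<close> in \<open>martingale_transport_pair\<close>.\<close>

lemma monotone_plan:
  obtains \<pi> Tm Tp where "\<pi> \<in> plans" "antimono Tm" "mono Tp"
    and "\<And>x. zml \<le> Tm x \<and> Tm x \<le> zmu" "\<And>x. zpl \<le> Tp x \<and> Tp x \<le> zpu"
    and "AE p in \<pi>. snd p = Tm (fst p) \<or> snd p = Tp (fst p)"
proof -
  interpret M: prob_space M by (rule prob_M)
  interpret N: prob_space N by (rule prob_N)
  \<comment> \<open>The carriers of \<open>M\<close> and \<open>N\<close> are \<open>X\<close> and
    \<open>Z\<close>, whereas the transport lemmas live on the whole line; the identity pushes both
    measures there.\<close>
  let ?M = "distr M borel (\<lambda>x. x)" and ?N = "distr N borel (\<lambda>x. x)"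
  have M': "real_distribution ?M" and N': "real_distribution ?N" by auto
  have atomless: "measure ?M {x} = 0" for x
  proof -
    have "emeasure ?M {x} = emeasure M ({x} \<inter> X)"
      by (subst emeasure_distr) (auto simp: vimage_def intro!: arg_cong[where f="emeasure M"])
    also have "\<dots> = 0"
      using emeasure_singleton_M[of x] by (cases "x \<in> X") auto
    finally show ?thesis by (simp add: measure_def)
  qed
  have supp: "AE z in ?N. zml \<le> z \<and> z \<le> zmu \<or> zpl \<le> z \<and> z \<le> zpu"
    by (subst AE_distr_iff) (auto intro!: AE_I2)
  have y': "y = (\<integral>z. z \<partial>?N)"
    by (subst integral_distr) (auto simp: y(3))
  obtain Tm Tp where T: "antimono Tm" "mono Tp"
      "\<And>x. zml \<le> Tm x \<and> Tm x \<le> zmu" "\<And>x. zpl \<le> Tp x \<and> Tp x \<le> zpu"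
      and marg': "\<And>B. B \<in> sets borel \<Longrightarrow> emeasure ?N B =
      (\<integral>\<^sup>+x. ennreal ((Tp x - y) / (Tp x - Tm x)) * indicator B (Tm x)
          + ennreal ((y - Tm x) / (Tp x - Tm x)) * indicator B (Tp x) \<partial>?M)"
    by (rule martingale_transport_pair[OF M' atomless N' supp y' y(1,2)], rule that)
  have "(\<lambda>x. - Tm x) \<in> borel_measurable borel"
    using T(1) by (intro borel_measurable_mono) (auto simp: mono_def antimono_def)
  then have Tm_b[measurable]: "Tm \<in> borel_measurable borel" by simp
  have Tp_b[measurable]: "Tp \<in> borel_measurable borel"
    using T(2) by (rule borel_measurable_mono)
  have TZ: "Tm x \<in> Z" "Tp x \<in> Z" "Tm x < y" "y < Tp x" for x
    using T(3,4)[of x] y by auto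
  have [measurable]: "Tm \<in> M \<rightarrow>\<^sub>M N" "Tp \<in> M \<rightarrow>\<^sub>M N"
    unfolding measurable_cong_sets[OF refl sets_N] using TZ(1,2)
      measurable_compose[OF ident_M Tm_b] measurable_compose[OF ident_M Tp_b]
    by (intro measurable_restrict_space2 funcsetI; simp only:)+
  define p where "p x = (Tp x - y) / (Tp x - Tm x)" for x
  have p01: "0 \<le> p x" "p x \<le> 1" and q: "1 - p x = (y - Tm x) / (Tp x - Tm x)" for x
    using TZ(3,4)[of x] by (auto simp: p_def field_simps)
  have p_b[measurable]: "p \<in> borel_measurable borel"
    unfolding p_def[abs_def] by measurable
  have [measurable]: "p \<in> borel_measurable M"
    using measurable_compose[OF ident_M p_b] by simp
  \<comment> \<open>A coin with success probability \<open>p x\<close> selects the left point, so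
    that integrals against \<open>\<kappa> x\<close> are two-term sums.\<close>
  define \<kappa> where "\<kappa> x = distr (measure_pmf (bernoulli_pmf (p x))) N (\<lambda>b. if b then Tm x else Tp x)" for x
  have sets_\<kappa>[simp]: "sets (\<kappa> x) = sets N" for x by (simp add: \<kappa>_def)
  have meas: "(\<lambda>b. if b then Tm x else Tp x) \<in> measure_pmf (bernoulli_pmf (p x)) \<rightarrow>\<^sub>M N" for x
    using TZ by auto
  have nn: "(\<integral>\<^sup>+z. f z \<partial>\<kappa> x) = ennreal (p x) * f (Tm x) + ennreal (1 - p x) * f (Tp x)"
    if [measurable]: "f \<in> borel_measurable N" for f x
    unfolding \<kappa>_def using p01[of x] meas
    by (subst nn_integral_distr) (auto simp: mult.commute)
  have prob_\<kappa>: "prob_space (\<kappa> x)" for x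
    unfolding \<kappa>_def by (rule measure_pmf.prob_space_distr[OF meas])
  have \<kappa>: "\<kappa> \<in> M \<rightarrow>\<^sub>M prob_algebra N"
  proof (intro measurable_prob_algebraI measurable_subprob_algebra prob_\<kappa> prob_space_imp_subprob_space sets_\<kappa>)
    fix A assume [measurable]: "A \<in> sets N"
    have "emeasure (\<kappa> x) A = ennreal (p x) * indicator A (Tm x) + ennreal (1 - p x) * indicator A (Tp x)" for x
      using nn[of "indicator A" x] by simp
    then show "(\<lambda>x. emeasure (\<kappa> x) A) \<in> borel_measurable M" by simp
  qed
  define \<pi> where "\<pi> = kernel_prod M N \<kappa>"
  have sets_\<pi>: "sets \<pi> = sets (M \<Otimes>\<^sub>M N)"
    unfolding \<pi>_def by (rule sets_kernel_prod[OF \<kappa>]) (rule M.not_empty)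
  have meas_\<pi>: "f \<in> M \<Otimes>\<^sub>M N \<rightarrow>\<^sub>M L \<Longrightarrow> f \<in> \<pi> \<rightarrow>\<^sub>M L" for f and L :: "'c measure"
    using measurable_cong_sets[OF sets_\<pi> refl] by blast
  have int_\<pi>: "(\<integral>\<^sup>+r. f r \<partial>\<pi>) =
      (\<integral>\<^sup>+x. ennreal (p x) * f (x, Tm x) + ennreal (1 - p x) * f (x, Tp x) \<partial>M)"
    if [measurable]: "f \<in> borel_measurable (M \<Otimes>\<^sub>M N)" for f
    unfolding \<pi>_def nn_integral_kernel_prod[OF \<kappa> that]
    by (intro nn_integral_cong) (subst nn, auto)
  have one: "ennreal (p x) + ennreal (1 - p x) = 1" for x
    using p01[of x] by (simp add: ennreal_plus[symmetric])
  have fst: "distr \<pi> M fst = M"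
  proof (rule measure_eqI)
    fix A assume "A \<in> sets (distr \<pi> M fst)"
    then have A[measurable]: "A \<in> sets M" by simp
    have "emeasure (distr \<pi> M fst) A = (\<integral>\<^sup>+x. indicator A x \<partial>distr \<pi> M fst)"
      by simp
    also have "\<dots> = (\<integral>\<^sup>+r. indicator A (fst r) \<partial>\<pi>)"
      by (rule nn_integral_distr[OF meas_\<pi>]) measurable
    also have "\<dots> = (\<integral>\<^sup>+x. indicator A x \<partial>M)"
      by (subst int_\<pi>) (auto simp: distrib_right[symmetric] one)
    finally show "emeasure (distr \<pi> M fst) A = emeasure M A" by simp
  qed simp
  have snd: "distr \<pi> N snd = N"
  proof (rule measure_eqI)
    fix A assume "A \<in> sets (distr \<pi> N snd)"
    then have A[measurable]: "A \<in> sets N" by simp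
    then have A': "A \<in> sets borel" "A \<subseteq> Z" by (auto simp: sets_N sets_restrict_space_iff)
    have "emeasure (distr \<pi> N snd) A = (\<integral>\<^sup>+x. indicator A x \<partial>distr \<pi> N snd)"
      by simp
    also have "\<dots> = (\<integral>\<^sup>+r. indicator A (snd r) \<partial>\<pi>)"
      by (rule nn_integral_distr[OF meas_\<pi>]) measurable
    also have "\<dots> = (\<integral>\<^sup>+x. ennreal (p x) * indicator A (Tm x) + ennreal (1 - p x) * indicator A (Tp x) \<partial>M)"
      by (subst int_\<pi>) auto
    also have "\<dots> = emeasure ?N A"
      unfolding marg'[OF A'(1)] using A'(1) by (subst nn_integral_distr) (auto simp: p_def[symmetric] q)
    also have "\<dots> = emeasure N A"
      using A' by (subst emeasure_distr) (auto simp: vimage_def Int_absorb2)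
    finally show "emeasure (distr \<pi> N snd) A = emeasure N A" .
  qed simp
  have "prob_space (distr \<pi> M fst)" unfolding fst by (rule prob_M)
  then have prob: "prob_space \<pi>"
    by (rule prob_space_distrD[OF meas_\<pi>[OF measurable_fst]])
  have mean: "(\<integral>z. z \<partial>\<kappa> x) = y" for x
  proof -
    have "(\<integral>z. z \<partial>\<kappa> x) = Tm x * p x + Tp x * (1 - p x)"
      unfolding \<kappa>_def using p01[of x] by (subst integral_distr[OF meas]) auto
    also have "\<dots> = y"
      unfolding q p_def using TZ(3,4)[of x] by (simp add: divide_simps) (simp add: algebra_simps)
    finally show ?thesis .
  qed
  have plan: "\<pi> \<in> plans"
    using \<kappa> mean sets_\<pi> prob fst snd \<pi>_def unfolding bar_couplings_def couplings_def by auto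
  have "AE r in \<pi>. snd r = Tm (fst r) \<or> snd r = Tp (fst r)"
  proof -
    \<comment> \<open>\<open>?f\<close> marks the points off the two graphs. It vanishes at
      \<open>(x, Tm x)\<close> and \<open>(x, Tp x)\<close>, hence its integral against
      \<open>\<pi>\<close> is zero.\<close>
    let ?f = "\<lambda>r. if snd r = Tm (fst r) \<or> snd r = Tp (fst r) then 0 else 1 :: ennreal"
    have f: "?f \<in> borel_measurable (M \<Otimes>\<^sub>M N)" by measurable
    have "integral\<^sup>N \<pi> ?f = 0"
      unfolding int_\<pi>[OF f] by (simp add: nn_integral_0_iff_AE)
    then have "AE r in \<pi>. ?f r = 0"
      by (subst (asm) nn_integral_0_iff_AE) (auto intro: meas_\<pi>[OF f])
    then show ?thesis
      by eventually_elim (auto split: if_splits)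
  qed
  with plan T show thesis by (rule that)
qed

end

subsection \<open>Excess over a chord\<close>

text \<open>The height of \<open>\<phi>\<close> over a chord with the denominator cleared. It is
  minus the determinant with rows \<open>(1, a, \<phi> a)\<close>, \<open>(1, z, \<phi> z)\<close>,
  \<open>(1, b, \<phi> b)\<close>: linear in \<open>\<phi>\<close>, alternating in the three points,
  zero for affine \<open>\<phi>\<close>.\<close>

definition gap :: "(real \<Rightarrow> real) \<Rightarrow> real \<Rightarrow> real \<Rightarrow> real \<Rightarrow> real" where
  "gap \<phi> a z b = (b - a) * \<phi> z - (b - z) * \<phi> a - (z - a) * \<phi> b"

text \<open>The formula is kept for \<open>z\<close> outside \<open>[a, b]\<close>, where it
  compares \<open>\<phi>\<close> with the extended chord.\<close>

definition excess :: "(real \<Rightarrow> real) \<Rightarrow> real \<Rightarrow> real \<Rightarrow> real \<Rightarrow> real" where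
  "excess \<phi> a b z = gap \<phi> a z b / (b - a)"

lemma excess_alt:
  "a < b \<Longrightarrow> excess \<phi> a b z = \<phi> z - (\<phi> a + (z - a) * ((\<phi> b - \<phi> a) / (b - a)))"
  by (simp add: excess_def gap_def field_simps)

lemma gap_add: "gap (\<lambda>z. \<phi> z + \<psi> z) a z b = gap \<phi> a z b + gap \<psi> a z b"
  by (simp add: gap_def algebra_simps)

lemma excess_ends[simp]: "excess \<phi> a b a = 0" "excess \<phi> a b b = 0"
  by (auto simp: excess_def gap_def algebra_simps)

lemma strictly_concave_on_gap:
  assumes "strictly_concave_on Z \<phi>" "a \<in> Z" "z \<in> Z" "b \<in> Z" "a < z" "z < b"
  shows "0 < gap \<phi> a z b"
proof -
  let ?t = "(z - a) / (b - a)"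
  have "?t * (b - a) = z - a" using assms by simp
  then have "(1 - ?t) * a + ?t * b = z" by (simp only: algebra_simps)
  moreover have "0 < ?t" "?t < 1" "1 - ?t = (b - z) / (b - a)"
    using assms by (auto simp: diff_divide_distrib[symmetric] divide_simps)
  ultimately have t: "0 < ?t" "?t < 1" "(1 - ?t) * a + ?t * b = z" "1 - ?t = (b - z) / (b - a)"
    by auto
  have "a < b" using assms by simp
  then have H: "(1 - t) * \<phi> a + t * \<phi> b < \<phi> ((1 - t) * a + t * b)"
    if "0 < t" "t < 1" "(1 - t) * a + t * b \<in> Z" for t
    using assms(1,2,4) that unfolding strictly_concave_on_def by blast
  have "(1 - ?t) * \<phi> a + ?t * \<phi> b < \<phi> z"
    using H[OF t(1,2)] assms(3) unfolding t(3) by simp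
  then have "(b - a) * ((b - z) / (b - a) * \<phi> a + ?t * \<phi> b) < (b - a) * \<phi> z"
    unfolding t(4) using assms by (intro mult_strict_left_mono) auto
  also have "(b - a) * ((b - z) / (b - a) * \<phi> a + ?t * \<phi> b) = (b - z) * \<phi> a + (z - a) * \<phi> b"
    using \<open>a < b\<close> by (simp add: distrib_left)
  finally show ?thesis by (simp add: gap_def)
qed

lemma gap_reflect: "gap (\<lambda>z. \<phi> (- z)) (- b) (- z) (- a) = gap \<phi> a z b"
  by (simp add: gap_def algebra_simps)

lemma excess_reflect: "excess (\<lambda>z. \<phi> (- z)) (- b) (- a) (- z) = excess \<phi> a b z"
  by (simp add: excess_def gap_reflect)

text \<open>Strict concavity on a set that may have a hole, expressed by three points of
  \<open>Z\<close> instead of a convex parameter. In this form it passes directly to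
  reflections.\<close>

locale concave_on_triples =
  fixes Z :: "real set" and \<phi> :: "real \<Rightarrow> real"
  assumes gap_pos: "\<And>a z b. a \<in> Z \<Longrightarrow> z \<in> Z \<Longrightarrow> b \<in> Z \<Longrightarrow> a < z \<Longrightarrow> z < b \<Longrightarrow> 0 < gap \<phi> a z b"
begin

lemma gap_nonneg: "a \<in> Z \<Longrightarrow> z \<in> Z \<Longrightarrow> b \<in> Z \<Longrightarrow> a \<le> z \<Longrightarrow> z \<le> b \<Longrightarrow> 0 \<le> gap \<phi> a z b"
  using gap_pos[of a z b] by (cases "a = z \<or> z = b") (auto simp: gap_def algebra_simps)

lemma excess_inside_nonneg:
  "a \<in> Z \<Longrightarrow> z \<in> Z \<Longrightarrow> b \<in> Z \<Longrightarrow> a \<le> z \<Longrightarrow> z \<le> b \<Longrightarrow> 0 \<le> excess \<phi> a b z"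
  using gap_nonneg[of a z b] by (simp add: excess_def)

text \<open>Swapping two points in \<open>gap\<close> changes its sign, and for \<open>z\<close>
  outside the interval the middle point is \<open>a\<close> or \<open>b\<close>.\<close>

lemma excess_outside_nonpos:
  assumes "a \<in> Z" "z \<in> Z" "b \<in> Z" "a < b" "z \<le> a \<or> b \<le> z"
  shows "excess \<phi> a b z \<le> 0"
proof -
  have "gap \<phi> a z b = - gap \<phi> z a b" "gap \<phi> a z b = - gap \<phi> a b z"
    by (auto simp: gap_def algebra_simps)
  then have "gap \<phi> a z b \<le> 0"
    using assms gap_nonneg[of z a b] gap_nonneg[of a b z] by auto
  then show ?thesis
    using assms by (simp add: excess_def divide_nonpos_pos)
qed

text \<open>The two chords meet over \<open>b\<close>, so their difference is affine in
  \<open>z\<close>, vanishes at \<open>b\<close>, and at \<open>a'\<close> equals the height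
  \<open>excess \<phi> a b a'\<close> of \<open>\<phi>\<close> over the longer chord.\<close>

lemma excess_mono_left:
  assumes "a \<in> Z" "a' \<in> Z" "b \<in> Z" "a \<le> a'" "a' < b" "z \<le> b"
  shows "excess \<phi> a' b z \<le> excess \<phi> a b z"
proof -
  have "excess \<phi> a b z - excess \<phi> a' b z = (b - z) / (b - a') * excess \<phi> a b a'"
    using assms by (simp add: excess_def gap_def divide_simps) (simp add: algebra_simps)
  also have "\<dots> \<ge> 0"
    using assms by (intro mult_nonneg_nonneg excess_inside_nonneg) auto
  finally show ?thesis by simp
qed

end

text \<open>Serves to obtain \<open>excess_mono_right\<close> and \<open>excess_right_bound\<close>
  from their left-hand versions.\<close>

lemma concave_on_triples_reflect:
  assumes "concave_on_triples Z \<phi>"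
  shows "concave_on_triples (uminus ` Z) (\<lambda>z. \<phi> (- z))"
proof
  fix a z b assume *: "a \<in> uminus ` Z" "z \<in> uminus ` Z" "b \<in> uminus ` Z" "a < z" "z < b"
  then have "0 < gap \<phi> (- b) (- z) (- a)"
    by (intro concave_on_triples.gap_pos[OF assms]) auto
  then show "0 < gap (\<lambda>z. \<phi> (- z)) a z b"
    using gap_reflect[of \<phi> "- a" "- z" "- b"] by simp
qed

context concave_on_triples
begin

lemma excess_mono_right:
  assumes "a \<in> Z" "b \<in> Z" "b' \<in> Z" "a < b'" "b' \<le> b" "a \<le> z"
  shows "excess \<phi> a b' z \<le> excess \<phi> a b z"
  using concave_on_triples.excess_mono_left[OF concave_on_triples_reflect[OF concave_on_triples_axioms],
      of "- b" "- b'" "- a" "- z"] assms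
  by (simp add: excess_reflect)

lemma excess_mono:
  assumes "a \<in> Z" "a' \<in> Z" "b \<in> Z" "b' \<in> Z" "a \<le> a'" "a' < b'" "b' \<le> b" "a' \<le> z" "z \<le> b'"
  shows "excess \<phi> a' b' z \<le> excess \<phi> a b z"
  using excess_mono_left[of a a' b z] excess_mono_right[of a' b b' z] assms by linarith

text \<open>The chord over \<open>[a, b]\<close>, extended to \<open>z < a\<close>, exceeds \<open>\<phi>\<close> at \<open>z\<close> by an amount
  that is controlled uniformly for \<open>a\<close> in \<open>[a1, a0]\<close> and \<open>b \<ge> b0\<close>.\<close>

lemma excess_left_bound:
  assumes Z: "z \<in> Z" "a1 \<in> Z" "a \<in> Z" "b0 \<in> Z" "b \<in> Z"
    and ord: "z < a1" "a1 \<le> a" "a < b0" "b0 \<le> b"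
    and d: "0 < d" "d \<le> b0 - a" and l: "b0 - z \<le> l"
  shows "d / l / l * gap \<phi> z a1 b0 \<le> - excess \<phi> a b z"
proof -
  have l0: "0 < l" using ord l by linarith
  have g: "0 \<le> gap \<phi> z a1 b0" "0 \<le> gap \<phi> a1 a b0" using ord Z by (auto intro!: gap_nonneg)
  \<comment> \<open>The constant is what remains of the true factor when the numerator is bounded
    below by \<open>d\<close> and both denominators above by \<open>l\<close>; it depends on neither
    \<open>a\<close> nor \<open>b\<close>.\<close>
  have "d / l / l * gap \<phi> z a1 b0 \<le> (b0 - a) / (b0 - a1) / (b0 - z) * gap \<phi> z a1 b0"
    using ord d l l0 g by (intro mult_right_mono frac_le divide_nonneg_pos) auto
  also have "\<dots> = (b0 - a) / (b0 - a1) * excess \<phi> z b0 a1"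
    by (simp add: excess_def)
  \<comment> \<open>The left side interpolates linearly between the excess at \<open>a1\<close> and
    the value zero at \<open>b0\<close>. By concavity it lies below the excess at \<open>a\<close>,
    and the \<open>gap\<close> term is the difference.\<close>
  also have "\<dots> = excess \<phi> z b0 a - gap \<phi> a1 a b0 / (b0 - a1)"
    using ord by (simp add: excess_def gap_def divide_simps) (simp add: algebra_simps)
  also have "\<dots> \<le> excess \<phi> z b0 a"
    using ord g by simp
  also have "\<dots> \<le> excess \<phi> z b a"
    using ord Z by (intro excess_mono_right) auto
  also have "\<dots> \<le> (b - z) / (b - a) * excess \<phi> z b a"
    using ord Z excess_inside_nonneg[of z a b]
      mult_right_mono[of 1 "(b - z) / (b - a)" "excess \<phi> z b a"] by (simp add: divide_simps)
  \<comment> \<open>\<open>z\<close> and \<open>a\<close> trade places in \<open>gap\<close>, which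
    accounts for the sign; the ratio corrects the chord length.\<close>
  also have "\<dots> = - excess \<phi> a b z"
    using ord by (simp add: excess_def gap_def divide_simps) (simp add: algebra_simps)
  finally show ?thesis .
qed

lemma excess_right_bound:
  assumes Z: "z \<in> Z" "b1 \<in> Z" "b \<in> Z" "a0 \<in> Z" "a \<in> Z"
    and ord: "b1 < z" "b \<le> b1" "a0 < b" "a \<le> a0"
    and d: "0 < d" "d \<le> b - a0" and l: "z - a0 \<le> l"
  shows "d / l / l * gap \<phi> a0 b1 z \<le> - excess \<phi> a b z"
  using concave_on_triples.excess_left_bound[OF concave_on_triples_reflect[OF concave_on_triples_axioms],
      of "- z" "- b1" "- b" "- a0" "- a" d l] assms
  by (simp add: excess_reflect gap_reflect)

end

subsection \<open>Comparison with a monotone plan\<close>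

text \<open>The comparison retains this much of \<open>monotone_plan\<close>: a plan carried by two
  graphs that move apart as \<open>x\<close> grows.\<close>

locale monotone_reference = barycentric_problem +
  fixes \<rho> :: "(real \<times> real) measure" and Tm Tp :: "real \<Rightarrow> real"
  assumes \<rho>: "\<rho> \<in> plans" and Tm_anti: "antimono Tm" and Tp_mono: "mono Tp"
    and Tm_range: "\<And>x. zml \<le> Tm x \<and> Tm x \<le> zmu"
    and Tp_range: "\<And>x. zpl \<le> Tp x \<and> Tp x \<le> zpu"
    and \<rho>_graph: "AE p in \<rho>. snd p = Tm (fst p) \<or> snd p = Tp (fst p)"
begin

lemma T_Z: "Tm x \<in> Z" "Tp x \<in> Z" "Tm x < Tp x" "Tm x < y" "y < Tp x"
  using Tm_range[of x] Tp_range[of x] y by auto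

lemma T_mono: "s \<le> t \<Longrightarrow> Tm t \<le> Tm s" "s \<le> t \<Longrightarrow> Tp s \<le> Tp t"
  using Tm_anti Tp_mono by (auto simp: antimono_def mono_def)

text \<open>The intervals \<open>[Tm x, Tp x]\<close> grow with \<open>x\<close>: for
  \<open>x < t\<close> their endpoints lie in the interval of \<open>t\<close>, for
  \<open>x \<ge> t\<close> outside its interior.\<close>

lemma \<rho>_ordered:
  "AE p in \<rho>. if t \<le> fst p then snd p \<le> Tm t \<or> Tp t \<le> snd p else Tm t \<le> snd p \<and> snd p \<le> Tp t"
  using \<rho>_graph
proof eventually_elim
  case (elim p)
  then show ?case
    using T_mono[of t "fst p"] T_mono[of "fst p" t] T_Z[of "fst p"] T_Z[of t] by auto
qed

definition upper :: "(real \<times> real) measure \<Rightarrow> real \<Rightarrow> (real \<Rightarrow> real) \<Rightarrow> real" where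
  "upper \<pi> t \<phi> = (\<integral>p. indicator {t..} (fst p) * \<phi> (snd p) \<partial>\<pi>)"

definition bounded_borel :: "(real \<Rightarrow> real) \<Rightarrow> bool" where
  "bounded_borel \<phi> \<longleftrightarrow> \<phi> \<in> borel_measurable N \<and> (\<exists>C. \<forall>z\<in>Z. \<bar>\<phi> z\<bar> \<le> C)"

lemma bounded_borel_measurable: "bounded_borel \<phi> \<Longrightarrow> \<phi> \<in> borel_measurable N"
  by (simp add: bounded_borel_def)

lemma bounded_borel_intros:
  "bounded_borel (\<lambda>z. c)" "bounded_borel (\<lambda>z. z)"
  "bounded_borel \<phi> \<Longrightarrow> bounded_borel \<psi> \<Longrightarrow> bounded_borel (\<lambda>z. \<phi> z + \<psi> z)" "bounded_borel \<phi> \<Longrightarrow> bounded_borel \<psi> \<Longrightarrow> bounded_borel (\<lambda>z. \<phi> z - \<psi> z)"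
  "bounded_borel \<phi> \<Longrightarrow> bounded_borel \<psi> \<Longrightarrow> bounded_borel (\<lambda>z. \<phi> z * \<psi> z)" "bounded_borel \<phi> \<Longrightarrow> bounded_borel (\<lambda>z. \<phi> z / c)"
  "bounded_borel \<phi> \<Longrightarrow> bounded_borel (\<lambda>z. max 0 (\<phi> z))" "bounded_borel \<phi> \<Longrightarrow> bounded_borel (\<lambda>z. - \<phi> z)"
proof -
  show "bounded_borel (\<lambda>z. c)" by (auto simp: bounded_borel_def)
  show "bounded_borel (\<lambda>z. z)" using abs_le_bound ident_N unfolding bounded_borel_def by blast
  { assume 1: "bounded_borel \<phi>" "bounded_borel \<psi>"
    then obtain C D where C: "\<And>z. z \<in> Z \<Longrightarrow> \<bar>\<phi> z\<bar> \<le> C" "\<And>z. z \<in> Z \<Longrightarrow> \<bar>\<psi> z\<bar> \<le> D"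
      unfolding bounded_borel_def by blast
    note [measurable] = 1[THEN bounded_borel_measurable]
    have "\<bar>\<phi> z + \<psi> z\<bar> \<le> C + D" "\<bar>\<phi> z - \<psi> z\<bar> \<le> C + D" if "z \<in> Z" for z
      using C[OF that] by auto
    then show "bounded_borel (\<lambda>z. \<phi> z + \<psi> z)" "bounded_borel (\<lambda>z. \<phi> z - \<psi> z)"
      unfolding bounded_borel_def by (auto intro!: exI[of _ "C + D"] simp del: Un_iff)
    have "\<bar>\<phi> z * \<psi> z\<bar> \<le> C * D" if "z \<in> Z" for z
      using C[OF that] by (auto simp: abs_mult intro!: mult_mono)
    then show "bounded_borel (\<lambda>z. \<phi> z * \<psi> z)"
      unfolding bounded_borel_def by (auto intro!: exI[of _ "C * D"] simp del: Un_iff) }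
  { assume 1: "bounded_borel \<phi>"
    then obtain C where C: "\<And>z. z \<in> Z \<Longrightarrow> \<bar>\<phi> z\<bar> \<le> C"
      unfolding bounded_borel_def by blast
    note [measurable] = 1[THEN bounded_borel_measurable]
    have "\<bar>\<phi> z / c\<bar> \<le> C / \<bar>c\<bar>" if "z \<in> Z" for z
      using C[OF that] by (auto intro!: divide_right_mono)
    then show "bounded_borel (\<lambda>z. \<phi> z / c)"
      unfolding bounded_borel_def by (auto intro!: exI[of _ "C / \<bar>c\<bar>"] simp del: Un_iff)
    have "\<bar>max 0 (\<phi> z)\<bar> \<le> C" if "z \<in> Z" for z
      using C[OF that] by auto
    then show "bounded_borel (\<lambda>z. max 0 (\<phi> z))"
      unfolding bounded_borel_def by (auto intro!: exI[of _ C] simp del: Un_iff)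
    show "bounded_borel (\<lambda>z. - \<phi> z)"
      using C unfolding bounded_borel_def by (auto intro!: exI[of _ C] simp del: Un_iff) }
qed

lemma bounded_borel_excess: "bounded_borel \<phi> \<Longrightarrow> bounded_borel (excess \<phi> a b)"
  unfolding excess_def[abs_def] gap_def by (intro bounded_borel_intros)

lemma bounded_borel_continuous: "continuous_on Z \<phi> \<Longrightarrow> bounded_borel \<phi>"
proof -
  assume c: "continuous_on Z \<phi>"
  have "compact Z" by (intro compact_Un) auto
  then have "bounded (\<phi> ` Z)"
    using c by (intro compact_imp_bounded compact_continuous_image)
  then obtain C where "\<And>z. z \<in> Z \<Longrightarrow> \<bar>\<phi> z\<bar> \<le> C"
    unfolding bounded_iff by (metis imageI real_norm_def)
  then show "bounded_borel \<phi>"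
    using borel_measurable_continuous_on_restrict[OF c]
    by (auto simp: bounded_borel_def measurable_cong_sets[OF sets_N refl] simp del: Un_iff)
qed

lemma integrable_bounded_borel:
  assumes "\<pi> \<in> plans" "bounded_borel \<phi>" "Measurable.pred (M \<Otimes>\<^sub>M N) P"
  shows "integrable \<pi> (\<lambda>p. (if P p then 1 else 0) * \<phi> (snd p))"
proof -
  note [measurable] = bounded_borel_measurable[OF assms(2)] assms(3)
  obtain C where C: "\<And>z. z \<in> Z \<Longrightarrow> \<bar>\<phi> z\<bar> \<le> C"
    using assms(2) unfolding bounded_borel_def by blast
  show ?thesis
  proof (rule plan_integrable[OF assms(1)])
    fix x z assume "z \<in> Z"
    then show "\<bar>(if P (x, z) then 1 else 0) * \<phi> (snd (x, z))\<bar> \<le> \<bar>C\<bar>"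
      using C[of z] by auto
  qed measurable
qed

lemma integrable_upper:
  assumes "\<pi> \<in> plans" "bounded_borel \<phi>"
  shows "integrable \<pi> (\<lambda>p. indicator {t..} (fst p) * \<phi> (snd p))"
proof -
  have "(\<lambda>p. indicator {t..} (fst p) * \<phi> (snd p)) = (\<lambda>p. (if t \<le> fst p then 1 else 0) * \<phi> (snd p))"
    by (auto simp: indicator_def)
  then show ?thesis
    using integrable_bounded_borel[OF assms, of "\<lambda>p. t \<le> fst p"] by simp
qed

text \<open>The linear part integrates to zero by \<open>plan_barycenter\<close>; the rest depends
  on \<open>M\<close> alone and is therefore common to all plans.\<close>

lemma upper_affine:
  assumes \<pi>: "\<pi> \<in> plans"
  shows "upper \<pi> t (\<lambda>z. \<alpha> + (z - y) * \<beta>) = \<alpha> * (\<integral>x. indicator {t..} x \<partial>M)"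
proof -
  have [measurable]: "{t..} \<inter> X \<in> sets M" by (auto simp: sets_M sets_restrict_space_iff)
  have "upper \<pi> t (\<lambda>z. \<alpha> + (z - y) * \<beta>)
      = (\<integral>p. \<alpha> * (indicator {t..} (fst p) * 1) + \<beta> * (indicator {t..} (fst p) * (snd p - y)) \<partial>\<pi>)"
    unfolding upper_def by (intro Bochner_Integration.integral_cong) (auto simp: algebra_simps)
  also have "\<dots> = \<alpha> * (\<integral>p. indicator {t..} (fst p) \<partial>\<pi>)
      + \<beta> * (\<integral>p. indicator {t..} (fst p) * (snd p - y) \<partial>\<pi>)"
    using integrable_upper[OF \<pi>, of "\<lambda>_. 1" t] integrable_upper[OF \<pi>, of "\<lambda>z. z - y" t]
    by (simp add: bounded_borel_intros)
  also have "(\<integral>p. indicator {t..} (fst p) * (snd p - y) \<partial>\<pi>)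
      = (\<integral>p. indicator ({t..} \<inter> X) (fst p) * (snd p - y) \<partial>\<pi>)"
    using plan_space[OF \<pi>] by (intro Bochner_Integration.integral_cong) (auto simp: indicator_def)
  also have "\<dots> = 0" by (rule plan_barycenter[OF \<pi>]) measurable
  also have "(\<integral>p. indicator {t..} (fst p) \<partial>\<pi> :: real) = (\<integral>x. indicator {t..} x \<partial>M)"
    by (rule plan_integral_fst[OF \<pi>]) measurable
  finally show ?thesis by simp
qed

lemma upper_add:
  assumes \<pi>: "\<pi> \<in> plans" "bounded_borel \<phi>" "bounded_borel \<psi>"
  shows "upper \<pi> t (\<lambda>z. \<phi> z + \<psi> z) = upper \<pi> t \<phi> + upper \<pi> t \<psi>"
  unfolding upper_def using integrable_upper[OF \<pi>(1,2), of t] integrable_upper[OF \<pi>(1,3), of t]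
  by (simp add: distrib_left)

definition advantage :: "(real \<times> real) measure \<Rightarrow> real \<Rightarrow> (real \<Rightarrow> real) \<Rightarrow> real" where
  "advantage \<pi> t \<phi> = upper \<pi> t \<phi> - upper \<rho> t \<phi>"

text \<open>Affine functions of \<open>z\<close> are invisible to \<open>advantage\<close>, so \<open>\<phi>\<close> may be replaced by its
  excess over any chord.\<close>

lemma advantage_excess:
  assumes \<pi>: "\<pi> \<in> plans" and \<phi>: "bounded_borel \<phi>" and "a < b"
  shows "advantage \<pi> t \<phi> = advantage \<pi> t (excess \<phi> a b)"
proof -
  define \<beta> where "\<beta> = (\<phi> b - \<phi> a) / (b - a)"
  define \<alpha> where "\<alpha> = \<phi> a + (y - a) * \<beta>"
  have eq: "\<phi> = (\<lambda>z. excess \<phi> a b z + (\<alpha> + (z - y) * \<beta>))"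
    using excess_alt[OF \<open>a < b\<close>, of \<phi>, folded \<beta>_def] by (simp add: \<alpha>_def algebra_simps)
  have "upper \<sigma> t \<phi> = upper \<sigma> t (excess \<phi> a b) + \<alpha> * (\<integral>x. indicator {t..} x \<partial>M)"
    if "\<sigma> \<in> plans" for \<sigma>
    by (subst eq, subst upper_add[OF that]) (auto intro!: bounded_borel_excess bounded_borel_intros \<phi> simp: upper_affine[OF that])
  then show ?thesis
    using \<pi> \<rho> by (simp add: advantage_def)
qed

text \<open>For concave \<open>\<phi>\<close> and \<open>z\<close> in \<open>Z\<close> this vanishes
  wherever \<open>p\<close> obeys the order of \<open>\<rho>_ordered\<close> at \<open>t\<close>, so
  it measures pointwise how a plan departs from that order.\<close>

definition defect :: "real \<Rightarrow> (real \<Rightarrow> real) \<Rightarrow> real \<times> real \<Rightarrow> real" where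
  "defect t \<phi> p = (if t \<le> fst p then max 0 (excess \<phi> (Tm t) (Tp t) (snd p))
     else max 0 (- excess \<phi> (Tm t) (Tp t) (snd p)))"

text \<open>Under \<open>\<rho>\<close> the order at \<open>t\<close> makes the excess on
  \<open>{x \<ge> t}\<close> equal to minus its negative part, a function of \<open>z\<close> only.
  Its integral is thus the same under \<open>\<pi>\<close>, and subtracting it from the integrand of
  \<open>upper \<pi> t\<close> leaves the defect.\<close>

lemma advantage_eq_defect:
  assumes \<pi>: "\<pi> \<in> plans" and \<phi>: "bounded_borel \<phi>" "concave_on_triples Z \<phi>"
  shows "advantage \<pi> t \<phi> = (\<integral>p. defect t \<phi> p \<partial>\<pi>)" "integrable \<pi> (defect t \<phi>)"
proof -
  interpret concave_on_triples Z \<phi> by fact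
  let ?h = "excess \<phi> (Tm t) (Tp t)"
  have h: "bounded_borel ?h" "bounded_borel (\<lambda>z. max 0 (- ?h z))" by (intro bounded_borel_intros bounded_borel_excess \<phi>)+
  note [measurable] = h[THEN bounded_borel_measurable]
  have "upper \<rho> t ?h = (\<integral>p. - max 0 (- ?h (snd p)) \<partial>\<rho>)"
    unfolding upper_def
  proof (rule integral_cong_AE)
    show "AE p in \<rho>. indicator {t..} (fst p) * ?h (snd p) = - max 0 (- ?h (snd p))"
      using \<rho>_ordered[of t] AE_space
    proof eventually_elim
      case (elim p)
      then have "snd p \<in> Z" using plan_space[OF \<rho>] by auto
      with elim show ?case
        using excess_outside_nonpos[of "Tm t" "snd p" "Tp t"] excess_inside_nonneg[of "Tm t" "snd p" "Tp t"] T_Z[of t]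
        by (auto simp: indicator_def max_def split: if_splits simp del: Un_iff)
    qed
  qed (auto intro!: plan_measurable[OF \<rho>])
  also have "\<dots> = (\<integral>p. - max 0 (- ?h (snd p)) \<partial>\<pi>)"
    using plan_integral_snd[OF \<pi>, of "\<lambda>z. - max 0 (- ?h z)"] plan_integral_snd[OF \<rho>, of "\<lambda>z. - max 0 (- ?h z)"]
    by simp
  finally have 1: "upper \<rho> t ?h = - (\<integral>p. max 0 (- ?h (snd p)) \<partial>\<pi>)" by simp
  have i: "integrable \<pi> (\<lambda>p. max 0 (- ?h (snd p)))"
    using integrable_bounded_borel[OF \<pi> h(2), of "\<lambda>_. True"] by simp
  have i': "integrable \<pi> (\<lambda>p. indicator {t..} (fst p) * ?h (snd p))"
    by (rule integrable_upper[OF \<pi> h(1)])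
  have d: "defect t \<phi> = (\<lambda>p. indicator {t..} (fst p) * ?h (snd p) + max 0 (- ?h (snd p)))"
    by (auto simp: defect_def fun_eq_iff max_def)
  have "advantage \<pi> t \<phi> = advantage \<pi> t ?h"
    by (rule advantage_excess[OF \<pi> \<phi>(1) T_Z(3)])
  also have "\<dots> = (\<integral>p. defect t \<phi> p \<partial>\<pi>)"
    unfolding advantage_def 1 d using i i' by (simp add: upper_def)
  finally show "advantage \<pi> t \<phi> = (\<integral>p. defect t \<phi> p \<partial>\<pi>)" .
  show "integrable \<pi> (defect t \<phi>)" unfolding d using i i' by simp
qed

end

subsection \<open>Optimality\<close>

locale monotone_reference_cost = monotone_reference +
  fixes c :: "real \<Rightarrow> real \<Rightarrow> real"
  assumes c_continuous: "continuous_on (X \<times> Z) (\<lambda>(x, z). c x z)"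
    and c_spence_mirrlees: "martingale_spence_mirrlees X Z c"
begin

lemma c_section: "x \<in> X \<Longrightarrow> continuous_on Z (c x)"
proof -
  assume "x \<in> X"
  then have "continuous_on Z ((\<lambda>(x, z). c x z) \<circ> Pair x)"
    by (intro continuous_on_compose continuous_on_subset[OF c_continuous] continuous_intros) auto
  then show ?thesis by (simp add: comp_def)
qed

lemma increment:
  assumes "s \<in> X" "u \<in> X"
  shows "continuous_on Z (\<lambda>z. c u z - c s z)"
    and "s < u \<Longrightarrow> strictly_concave_on Z (\<lambda>z. c u z - c s z)"
  using assms c_spence_mirrlees
  by (auto intro!: continuous_intros c_section simp: martingale_spence_mirrlees_def simp del: Un_iff)

definition clamp :: "real \<Rightarrow> real \<Rightarrow> real \<Rightarrow> real" where
  "clamp s u x = max s (min u x)"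

lemma clamp_X: "s \<in> X \<Longrightarrow> u \<in> X \<Longrightarrow> s \<le> u \<Longrightarrow> clamp s u x \<in> X"
  by (auto simp: clamp_def)

lemma clamped_cost_integrable:
  assumes \<pi>: "\<pi> \<in> plans" and su: "s \<in> X" "u \<in> X" "s \<le> u"
  shows "integrable \<pi> (\<lambda>p. c (clamp s u (fst p)) (snd p))"
proof -
  have "compact (X \<times> Z)" by (intro compact_Times compact_Un) auto
  then have "bounded ((\<lambda>(x, z). c x z) ` (X \<times> Z))"
    using c_continuous by (intro compact_imp_bounded compact_continuous_image)
  then obtain C where C: "\<And>x z. x \<in> X \<Longrightarrow> z \<in> Z \<Longrightarrow> \<bar>c x z\<bar> \<le> C"
    unfolding bounded_iff by (metis (no_types, lifting) SigmaI case_prod_conv image_eqI real_norm_def)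
  have "(\<lambda>p. (clamp s u (fst p), snd p)) \<in> M \<Otimes>\<^sub>M N \<rightarrow>\<^sub>M restrict_space borel (X \<times> Z)"
  proof (rule measurable_restrict_space2)
    show "(\<lambda>p. (clamp s u (fst p), snd p)) \<in> space (M \<Otimes>\<^sub>M N) \<rightarrow> X \<times> Z"
      using clamp_X[OF su] by (auto simp: space_pair_measure)
    show "(\<lambda>p. (clamp s u (fst p), snd p)) \<in> M \<Otimes>\<^sub>M N \<rightarrow>\<^sub>M borel"
      unfolding clamp_def borel_prod[symmetric] by measurable
  qed
  from measurable_compose[OF this borel_measurable_continuous_on_restrict[OF c_continuous]]
  have "(\<lambda>p. c (clamp s u (fst p)) (snd p)) \<in> borel_measurable (M \<Otimes>\<^sub>M N)" by simp
  then show ?thesis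
    by (rule plan_integrable[OF \<pi>]) (simp only: fst_conv snd_conv, rule C[OF clamp_X[OF su]])
qed

text \<open>Clamping confines the variation of the cost in \<open>x\<close> to
  \<open>[s, u]\<close>, so this is the share of the cost difference due to increments of
  \<open>c\<close> over that interval. It stands in for an integral of the derivative of
  \<open>c\<close> in \<open>x\<close>, which need not exist.\<close>

definition slice :: "(real \<times> real) measure \<Rightarrow> real \<Rightarrow> real \<Rightarrow> real" where
  "slice \<pi> s u = (\<integral>p. c (clamp s u (fst p)) (snd p) \<partial>\<pi>) - (\<integral>p. c (clamp s u (fst p)) (snd p) \<partial>\<rho>)"

lemma section_integrable: "\<pi> \<in> plans \<Longrightarrow> x \<in> X \<Longrightarrow> integrable \<pi> (\<lambda>p. c x (snd p))"
  using integrable_bounded_borel[OF _ bounded_borel_continuous[OF c_section], of \<pi> x "\<lambda>_. True"] by simp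

lemma section_integral:
  assumes "\<pi> \<in> plans" "x \<in> X"
  shows "(\<integral>p. c x (snd p) \<partial>\<pi>) = (\<integral>z. c x z \<partial>N)"
  by (rule plan_integral_snd[OF assms(1) bounded_borel_measurable[OF bounded_borel_continuous[OF c_section[OF assms(2)]]]])

lemma slice_relative:
  assumes "\<pi> \<in> plans" "s \<in> X" "u \<in> X" "s \<le> u"
  shows "slice \<pi> s u = (\<integral>p. c (clamp s u (fst p)) (snd p) - c s (snd p) \<partial>\<pi>)
    - (\<integral>p. c (clamp s u (fst p)) (snd p) - c s (snd p) \<partial>\<rho>)"
  using assms \<rho> by (simp add: slice_def clamped_cost_integrable section_integrable section_integral)

lemma slice_same: "\<pi> \<in> plans \<Longrightarrow> s \<in> X \<Longrightarrow> slice \<pi> s s = 0"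
  using slice_relative[of \<pi> s s] by (simp add: clamp_def)

lemma slice_add:
  assumes \<pi>: "\<pi> \<in> plans" and X: "s \<in> X" "m \<in> X" "u \<in> X" "s \<le> m" "m \<le> u"
  shows "slice \<pi> s u = slice \<pi> s m + slice \<pi> m u"
proof -
  have su: "s \<le> u" using X by simp
  \<comment> \<open>The increment telescopes at \<open>m\<close>. The correction
    \<open>c m z\<close> depends on \<open>z\<close> alone, has the same integral under both plans,
    and cancels in \<open>slice\<close>.\<close>
  have eq: "c (clamp s u x) z = c (clamp s m x) z + (c (clamp m u x) z - c m z)" for x z
    using X by (cases "x \<le> m") (auto simp: clamp_def min_def max_def)
  have "(\<integral>p. c (clamp s u (fst p)) (snd p) \<partial>\<sigma>) = (\<integral>p. c (clamp s m (fst p)) (snd p) \<partial>\<sigma>)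
      + ((\<integral>p. c (clamp m u (fst p)) (snd p) \<partial>\<sigma>) - (\<integral>z. c m z \<partial>N))" if "\<sigma> \<in> plans" for \<sigma>
    using X su that unfolding eq by (simp add: clamped_cost_integrable section_integrable section_integral)
  then show ?thesis using \<pi> \<rho> by (simp add: slice_def)
qed

definition below :: "real \<Rightarrow> real" where
  "below t = measure M {x\<in>X. x < t}"

lemma band_integral:
  assumes \<pi>: "\<pi> \<in> plans" and su: "s \<le> u"
  shows "(\<integral>p. indicator {s..<u} (fst p) \<partial>\<pi>) = below u - below s"
    and "integrable \<pi> (\<lambda>p. indicator {s..<u} (fst p) :: real)"
proof -
  interpret M: prob_space M by (rule prob_M)
  have below_sets: "{x\<in>X. x < t} \<in> sets M" for t
    by (auto simp: sets_M sets_restrict_space_iff)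
  have "(\<integral>p. indicator {s..<u} (fst p) \<partial>\<pi> :: real) = (\<integral>x. indicator {s..<u} x \<partial>M)"
    by (rule plan_integral_fst[OF \<pi>]) measurable
  also have "\<dots> = (\<integral>x. indicator ({x\<in>X. x < u} - {x\<in>X. x < s}) x \<partial>M)"
    by (intro Bochner_Integration.integral_cong) (auto simp: indicator_def)
  also have "\<dots> = measure M ({x\<in>X. x < u} - {x\<in>X. x < s})"
    by (auto intro!: arg_cong[where f="measure M"])
  also have "\<dots> = below u - below s"
    unfolding below_def using su by (intro M.finite_measure_Diff below_sets) auto
  finally show "(\<integral>p. indicator {s..<u} (fst p) \<partial>\<pi>) = below u - below s" .
  show "integrable \<pi> (\<lambda>p. indicator {s..<u} (fst p) :: real)"
    by (intro plan_integrable[OF \<pi>, where C=1]) (auto simp: indicator_def)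
qed

text \<open>Relative to \<open>c s z\<close>, the clamped cost is zero for \<open>x < s\<close> and
  the full increment for \<open>x \<ge> u\<close>. Only the band between contributes an error, at
  most \<open>e\<close> times its mass, once for \<open>\<pi>\<close> and once for
  \<open>\<rho>\<close>.\<close>

lemma slice_local:
  assumes \<pi>: "\<pi> \<in> plans" and X: "s \<in> X" "u \<in> X" "s \<le> u"
    and osc: "\<And>x z. s \<le> x \<Longrightarrow> x \<le> u \<Longrightarrow> z \<in> Z \<Longrightarrow> \<bar>c x z - c s z\<bar> \<le> e"
  shows "advantage \<pi> u (\<lambda>z. c u z - c s z) - 2 * e * (below u - below s) \<le> slice \<pi> s u"
proof -
  let ?\<Phi> = "\<lambda>z. c u z - c s z"
  let ?f = "\<lambda>p. c (clamp s u (fst p)) (snd p) - c s (snd p)"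
  let ?g = "\<lambda>p. indicator {u..} (fst p) * ?\<Phi> (snd p)"
  let ?r = "\<lambda>p. indicator {s..<u} (fst p) :: real"
  have bound: "\<bar>?f p - ?g p\<bar> \<le> e * ?r p" if "snd p \<in> Z" for p
  proof -
    consider "fst p < s" | "s \<le> fst p" "fst p < u" | "u \<le> fst p" by linarith
    then show ?thesis
      using X osc[of "fst p" "snd p"] that by cases (auto simp: clamp_def min_def max_def)
  qed
  have *: "\<bar>(\<integral>p. ?f p \<partial>\<sigma>) - upper \<sigma> u ?\<Phi>\<bar> \<le> e * (below u - below s)" if \<sigma>: "\<sigma> \<in> plans" for \<sigma>
  proof -
    have i: "integrable \<sigma> ?f" "integrable \<sigma> ?g" "integrable \<sigma> ?r"
      using clamped_cost_integrable[OF \<sigma> X] section_integrable[OF \<sigma> X(1)] band_integral(2)[OF \<sigma> X(3)]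
        integrable_upper[OF \<sigma> bounded_borel_continuous[OF increment(1)[OF X(1,2)]]] by auto
    have "\<bar>(\<integral>p. ?f p \<partial>\<sigma>) - upper \<sigma> u ?\<Phi>\<bar> = \<bar>\<integral>p. ?f p - ?g p \<partial>\<sigma>\<bar>"
      using i unfolding upper_def by (subst Bochner_Integration.integral_diff) auto
    also have "\<dots> \<le> (\<integral>p. \<bar>?f p - ?g p\<bar> \<partial>\<sigma>)" by (rule integral_abs_bound)
    also have "\<dots> \<le> (\<integral>p. e * ?r p \<partial>\<sigma>)"
    proof (rule integral_mono)
      show "integrable \<sigma> (\<lambda>p. \<bar>?f p - ?g p\<bar>)"
        using i by (intro integrable_abs Bochner_Integration.integrable_diff[of \<sigma> ?f ?g])
      show "integrable \<sigma> (\<lambda>p. e * ?r p)" using i by simp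
      show "\<bar>?f p - ?g p\<bar> \<le> e * ?r p" if "p \<in> space \<sigma>" for p
        using that plan_space[OF \<sigma>] by (intro bound) auto
    qed
    also have "\<dots> = e * (below u - below s)"
      using band_integral(1)[OF \<sigma> X(3)] by simp
    finally show ?thesis .
  qed
  show ?thesis
    using *[OF \<pi>] *[OF \<rho>] unfolding slice_relative[OF \<pi> X] advantage_def by linarith
qed

text \<open>Both sides are additive over adjacent intervals, so the local estimate summed over ever
  finer subdivisions gives the global one.\<close>

lemma slice_lower:
  assumes \<pi>: "\<pi> \<in> plans" and X: "s \<in> X" "u \<in> X" "s < u"
    and L_add: "\<And>\<phi> \<psi>. continuous_on Z \<phi> \<Longrightarrow> continuous_on Z \<psi> \<Longrightarrow> L (\<lambda>z. \<phi> z + \<psi> z) = L \<phi> + L \<psi>"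
    and L_le: "\<And>t \<phi>. s \<le> t \<Longrightarrow> t \<le> u \<Longrightarrow> continuous_on Z \<phi> \<Longrightarrow> strictly_concave_on Z \<phi> \<Longrightarrow>
      L \<phi> \<le> advantage \<pi> t \<phi>"
  shows "L (\<lambda>z. c u z - c s z) \<le> slice \<pi> s u"
proof -
  define E where "E s u = slice \<pi> s u - L (\<lambda>z. c u z - c s z)" for s u
  have E_add: "E s' u' = E s' m + E m u'" if "s' \<in> X" "m \<in> X" "u' \<in> X" "s' \<le> m" "m \<le> u'" for s' m u'
    using L_add[OF increment(1)[OF that(1,2)] increment(1)[OF that(2,3)]] slice_add[OF \<pi> that]
    by (simp add: E_def)
  have below_le: "0 \<le> below t" "below t \<le> 1" for t
    using prob_space.prob_le_1[OF prob_M] by (auto simp: below_def)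
  have approx: "- 2 * e \<le> E s u" if "0 < e" for e
  proof -
    have "compact (X \<times> Z)" by (intro compact_Times compact_Un) auto
    then have "uniformly_continuous_on (X \<times> Z) (\<lambda>(x, z). c x z)"
      using c_continuous by (rule compact_uniformly_continuous[rotated])
    then obtain d where d: "0 < d" and "\<And>p q. p \<in> X \<times> Z \<Longrightarrow> q \<in> X \<times> Z \<Longrightarrow> dist q p < d \<Longrightarrow>
        dist ((\<lambda>(x, z). c x z) q) ((\<lambda>(x, z). c x z) p) < e"
      using \<open>0 < e\<close> unfolding uniformly_continuous_on_def by metis
    from this(2)[of "(_, _)" "(_, _)"]
    have osc: "\<bar>c x z - c x' z\<bar> \<le> e" if "x \<in> X" "x' \<in> X" "z \<in> Z" "\<bar>x - x'\<bar> < d" for x x' z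
      using that by (auto simp: dist_Pair_Pair dist_real_def less_imp_le simp del: Un_iff)
    \<comment> \<open>Bisection down to pieces shorter than \<open>d\<close>, where
      \<open>slice_local\<close> applies. The errors telescope because each is proportional to the
      mass of its band, so the number of pieces does not matter.\<close>
    have "- 2 * e * (below u' - below s') \<le> E s' u'"
      if "s \<le> s'" "s' < u'" "u' \<le> u" "u' - s' < d * 2 ^ n" for n s' u'
      using that
    proof (induction n arbitrary: s' u')
      case 0
      then have X': "s' \<in> X" "u' \<in> X" using X by auto
      have "\<bar>c x z - c s' z\<bar> \<le> e" if "s' \<le> x" "x \<le> u'" "z \<in> Z" for x z
        using that 0 X' by (intro osc) auto
      then have "advantage \<pi> u' (\<lambda>z. c u' z - c s' z) - 2 * e * (below u' - below s') \<le> slice \<pi> s' u'"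
        using 0 by (intro slice_local[OF \<pi> X']) auto
      moreover have "L (\<lambda>z. c u' z - c s' z) \<le> advantage \<pi> u' (\<lambda>z. c u' z - c s' z)"
        using 0 X' by (intro L_le increment) auto
      ultimately show ?case by (simp add: E_def)
    next
      case (Suc n)
      let ?m = "(s' + u') / 2"
      have "E s' u' = E s' ?m + E ?m u'"
        using Suc.prems X by (intro E_add) auto
      moreover have "- 2 * e * (below ?m - below s') \<le> E s' ?m" "- 2 * e * (below u' - below ?m) \<le> E ?m u'"
        using Suc.prems by (intro Suc.IH; simp add: field_simps)+
      ultimately show ?case by (simp add: algebra_simps)
    qed
    moreover obtain n where "(u - s) / d < 2 ^ n"
      using real_arch_pow[of 2 "(u - s) / d"] by auto
    ultimately have "- 2 * e * (below u - below s) \<le> E s u"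
      using X d by (simp add: field_simps)
    moreover have "e * (below u - below s) \<le> e * 1"
      using below_le[of u] below_le[of s] \<open>0 < e\<close> by (intro mult_left_mono) auto
    ultimately show ?thesis by simp
  qed
  have "0 \<le> E s u"
  proof (rule field_le_epsilon)
    fix e :: real assume "0 < e"
    then show "0 \<le> E s u + e" using approx[of "e / 2"] by simp
  qed
  then show ?thesis by (simp add: E_def)
qed

end

lemma concave_on_triplesI: "strictly_concave_on Z \<phi> \<Longrightarrow> concave_on_triples Z \<phi>"
  by standard (rule strictly_concave_on_gap)

section \<open>Nonnegative slices and optimality of the reference plan\<close>

context monotone_reference_cost
begin

lemma defect_nonneg: "0 \<le> defect t \<phi> p"
  by (simp add: defect_def)

lemma slice_nonneg:
  assumes \<pi>: "\<pi> \<in> plans" and X: "s \<in> X" "u \<in> X" "s \<le> u"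
  shows "0 \<le> slice \<pi> s u"
proof (cases "s = u")
  case True
  then show ?thesis using slice_same[OF \<pi> X(1)] by simp
next
  case False
  show ?thesis
  \<comment> \<open>The zero functional is an admissible lower bound because the defect is
    nonnegative.\<close>
  proof (rule slice_lower[OF \<pi> X(1,2), where L="\<lambda>_. 0"])
    fix t \<phi> assume \<phi>: "continuous_on Z \<phi>" "strictly_concave_on Z \<phi>"
    show "0 \<le> advantage \<pi> t \<phi>"
      unfolding advantage_eq_defect(1)[OF \<pi> bounded_borel_continuous[OF \<phi>(1)] concave_on_triplesI[OF \<phi>(2)]]
      by (intro Bochner_Integration.integral_nonneg defect_nonneg)
  qed (use False X in auto)
qed

lemma slice_total:
  assumes "\<pi> \<in> plans"
  shows "slice \<pi> xl xu = (\<integral>(x, z). c x z \<partial>\<pi>) - (\<integral>(x, z). c x z \<partial>\<rho>)"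
proof -
  have "(\<integral>p. c (clamp xl xu (fst p)) (snd p) \<partial>\<sigma>) = (\<integral>(x, z). c x z \<partial>\<sigma>)" if "\<sigma> \<in> plans" for \<sigma>
    using plan_space[OF that]
    by (intro Bochner_Integration.integral_cong) (auto simp: clamp_def min_def max_def)
  then show ?thesis using assms \<rho> by (simp add: slice_def)
qed

lemma X_nonempty: "xl \<le> xu"
  using prob_space.not_empty[OF prob_M] by simp

lemma reference_optimal:
  assumes "\<pi> \<in> plans"
  shows "(\<integral>(x, z). c x z \<partial>\<rho>) \<le> (\<integral>(x, z). c x z \<partial>\<pi>)"
  using slice_nonneg[OF assms, of xl xu] slice_total[OF assms] X_nonempty by simp

end

subsection \<open>Uniqueness\<close>

locale competing_plan = monotone_reference_cost +
  fixes \<pi> :: "(real \<times> real) measure"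
  assumes \<pi>: "\<pi> \<in> plans" and le: "(\<integral>(x, z). c x z \<partial>\<pi>) \<le> (\<integral>(x, z). c x z \<partial>\<rho>)"
begin

text \<open>\<open>e\<close> bounds the defect on \<open>P\<close> from below simultaneously for all
  \<open>t\<close> in \<open>[t0, t1]\<close>, so its integral over \<open>P\<close> is a functional
  \<open>L\<close> fit for \<open>slice_lower\<close>. The slice of a plan as cheap as
  \<open>\<rho>\<close> is at most zero; hence the integral vanishes although \<open>e\<close> is
  positive on \<open>P\<close>, and \<open>P\<close> is null.\<close>

lemma null_region:
  assumes X: "t0 \<in> X" "t1 \<in> X" "t0 < t1"
    and P: "Measurable.pred (M \<Otimes>\<^sub>M N) P"
    and e_add: "\<And>\<phi> \<psi> z. e (\<lambda>z. \<phi> z + \<psi> z) z = e \<phi> z + e \<psi> z"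
    and e_bounded: "\<And>\<phi>. continuous_on Z \<phi> \<Longrightarrow> bounded_borel (e \<phi>)"
    and e_le: "\<And>t \<phi> x z. t0 \<le> t \<Longrightarrow> t \<le> t1 \<Longrightarrow> concave_on_triples Z \<phi> \<Longrightarrow> z \<in> Z \<Longrightarrow> P (x, z) \<Longrightarrow>
      e \<phi> z \<le> defect t \<phi> (x, z)"
    and e_pos: "\<And>\<phi> x z. concave_on_triples Z \<phi> \<Longrightarrow> z \<in> Z \<Longrightarrow> P (x, z) \<Longrightarrow> 0 < e \<phi> z"
  shows "AE p in \<pi>. \<not> P p"
proof -
  define L where "L \<phi> = (\<integral>p. (if P p then 1 else 0) * e \<phi> (snd p) \<partial>\<pi>)" for \<phi>
  have int: "integrable \<pi> (\<lambda>p. (if P p then 1 else 0) * e \<phi> (snd p))" if "continuous_on Z \<phi>" for \<phi>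
    using e_bounded[OF that] by (rule integrable_bounded_borel[OF \<pi> _ P])
  let ?\<Phi> = "\<lambda>z. c t1 z - c t0 z"
  have "L ?\<Phi> \<le> slice \<pi> t0 t1"
  proof (rule slice_lower[OF \<pi> X])
    fix \<phi> \<psi> :: "real \<Rightarrow> real" assume "continuous_on Z \<phi>" "continuous_on Z \<psi>"
    then show "L (\<lambda>z. \<phi> z + \<psi> z) = L \<phi> + L \<psi>"
      unfolding L_def e_add distrib_left by (intro Bochner_Integration.integral_add int)
  next
    fix t \<phi> assume t: "t0 \<le> t" "t \<le> t1" and \<phi>: "continuous_on Z \<phi>" "strictly_concave_on Z \<phi>"
    note \<phi>' = bounded_borel_continuous[OF \<phi>(1)] concave_on_triplesI[OF \<phi>(2)]
    show "L \<phi> \<le> advantage \<pi> t \<phi>"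
      unfolding advantage_eq_defect(1)[OF \<pi> \<phi>'] L_def
    proof (rule integral_mono[OF int[OF \<phi>(1)] advantage_eq_defect(2)[OF \<pi> \<phi>']])
      fix p assume "p \<in> space \<pi>"
      then have "snd p \<in> Z" using plan_space[OF \<pi>] by auto
      then show "(if P p then 1 else 0) * e \<phi> (snd p) \<le> defect t \<phi> p"
        using e_le[OF t \<phi>'(2), of "snd p" "fst p"] defect_nonneg[of t \<phi> p] by auto
    qed
  qed
  \<comment> \<open>The slices to the left of \<open>t0\<close> and to the right of
    \<open>t1\<close> are nonnegative.\<close>
  also have "\<dots> \<le> slice \<pi> xl xu"
    using slice_add[OF \<pi>, of xl t0 xu] slice_add[OF \<pi>, of t0 t1 xu]
      slice_nonneg[OF \<pi>, of xl t0] slice_nonneg[OF \<pi>, of t1 xu] X by auto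
  also have "\<dots> \<le> 0" using slice_total[OF \<pi>] le by simp
  finally have "L ?\<Phi> \<le> 0" .
  note conc = concave_on_triplesI[OF increment(2)[OF X]]
  have pos: "0 < e ?\<Phi> (snd p)" if "p \<in> space \<pi>" "P p" for p
  proof (rule e_pos[OF conc])
    show "snd p \<in> Z" using that(1) plan_space[OF \<pi>] by auto
    show "P (fst p, snd p)" using that(2) by simp
  qed
  then have nonneg: "0 \<le> (if P p then 1 else 0) * e ?\<Phi> (snd p)" if "p \<in> space \<pi>" for p
    using pos[OF that] by (simp add: less_imp_le)
  then have "0 \<le> L ?\<Phi>"
    unfolding L_def by (intro Bochner_Integration.integral_nonneg)
  with \<open>L ?\<Phi> \<le> 0\<close> have "L ?\<Phi> = 0" by simp
  moreover have "AE p in \<pi>. 0 \<le> (if P p then 1 else 0) * e ?\<Phi> (snd p)"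
    using nonneg by (rule AE_I2)
  ultimately have "AE p in \<pi>. (if P p then 1 else 0) * e ?\<Phi> (snd p) = 0"
    unfolding L_def using integral_nonneg_eq_0_iff_AE[OF int[OF increment(1)[OF X(1,2)]]] by blast
  then show ?thesis
    using AE_space by eventually_elim (use pos in force)
qed

text \<open>Among the intervals for \<open>t\<close> in \<open>[t0, t1]\<close> the one at
  \<open>t0\<close> is smallest, and by \<open>excess_mono\<close> so is the excess over its
  chord.\<close>

lemma null_inside:
  assumes X: "t0 \<in> X" "t1 \<in> X" "t0 < t1"
  shows "AE p in \<pi>. \<not> (t1 \<le> fst p \<and> Tm t0 < snd p \<and> snd p < Tp t0)"
proof (rule null_region[OF X, where e="\<lambda>\<phi>. excess \<phi> (Tm t0) (Tp t0)"])
  fix \<phi> \<psi> z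
  show "excess (\<lambda>z. \<phi> z + \<psi> z) (Tm t0) (Tp t0) z = excess \<phi> (Tm t0) (Tp t0) z + excess \<psi> (Tm t0) (Tp t0) z"
    by (simp add: excess_def gap_add add_divide_distrib)
next
  fix t \<phi> x z
  assume *: "t0 \<le> t" "t \<le> t1" "concave_on_triples Z \<phi>" "z \<in> Z"
    "t1 \<le> fst (x, z) \<and> Tm t0 < snd (x, z) \<and> snd (x, z) < Tp t0"
  have "excess \<phi> (Tm t0) (Tp t0) z \<le> excess \<phi> (Tm t) (Tp t) z"
    using * T_mono[of t0 t] T_Z by (intro concave_on_triples.excess_mono[OF *(3)]) (auto simp del: Un_iff)
  then show "excess \<phi> (Tm t0) (Tp t0) z \<le> defect t \<phi> (x, z)"
    using * by (simp add: defect_def)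
next
  fix \<phi> x z
  assume *: "concave_on_triples Z \<phi>" "z \<in> Z"
    "t1 \<le> fst (x, z) \<and> Tm t0 < snd (x, z) \<and> snd (x, z) < Tp t0"
  then have "0 < gap \<phi> (Tm t0) z (Tp t0)"
    using T_Z[of t0] by (intro concave_on_triples.gap_pos[OF *(1)]) auto
  then show "0 < excess \<phi> (Tm t0) (Tp t0) z"
    using T_Z(3)[of t0] by (simp add: excess_def)
qed (measurable, auto intro: bounded_borel_excess bounded_borel_continuous)

text \<open>For \<open>z\<close> left of \<open>Tm t1\<close> the chord at \<open>t\<close> lies
  above \<open>\<phi>\<close>, by an amount that \<open>excess_left_bound\<close> controls through
  the extreme points \<open>Tm t1\<close> and \<open>Tp t0\<close>. The constants are the width
  \<open>d\<close> of the hole between the two intervals and the length \<open>l\<close> of their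
  hull.\<close>

lemma null_left:
  assumes X: "t0 \<in> X" "t1 \<in> X" "t0 < t1"
  shows "AE p in \<pi>. \<not> (fst p < t0 \<and> snd p < Tm t1)"
proof -
  define d where "d = zpl - zmu"
  define l where "l = zpu - zml"
  have dl: "0 < d" "0 < l"
    using y T_Z(3)[of t0] Tm_range[of t0] Tp_range[of t0] by (auto simp: d_def l_def)
  show ?thesis
  proof (rule null_region[OF X, where e="\<lambda>\<phi> z. d / l / l * gap \<phi> z (Tm t1) (Tp t0)"])
    fix t \<phi> x z
    assume *: "t0 \<le> t" "t \<le> t1" "concave_on_triples Z \<phi>" "z \<in> Z"
      "fst (x, z) < t0 \<and> snd (x, z) < Tm t1"
    have "d / l / l * gap \<phi> z (Tm t1) (Tp t0) \<le> - excess \<phi> (Tm t) (Tp t) z"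
      using * T_mono[of t0 t] T_mono[of t t1] T_Z[of t] T_Z[of t1] T_Z[of t0] Tm_range[of t] Tp_range[of t0] dl
      by (intro concave_on_triples.excess_left_bound[OF *(3)]) (auto simp: d_def l_def)
    then show "d / l / l * gap \<phi> z (Tm t1) (Tp t0) \<le> defect t \<phi> (x, z)"
      using * by (simp add: defect_def)
  next
    fix \<phi> x z
    assume *: "concave_on_triples Z \<phi>" "z \<in> Z" "fst (x, z) < t0 \<and> snd (x, z) < Tm t1"
    then have "0 < gap \<phi> z (Tm t1) (Tp t0)"
      using T_Z[of t1] T_Z[of t0]
      by (intro concave_on_triples.gap_pos[OF *(1)]) (auto simp del: Un_iff)
    then show "0 < d / l / l * gap \<phi> z (Tm t1) (Tp t0)"
      using dl by simp
  next
    fix \<phi> :: "real \<Rightarrow> real" assume "continuous_on Z \<phi>"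
    then show "bounded_borel (\<lambda>z. d / l / l * gap \<phi> z (Tm t1) (Tp t0))"
      unfolding gap_def by (intro bounded_borel_intros bounded_borel_continuous)
  qed (measurable, simp add: gap_add algebra_simps)
qed

lemma null_right:
  assumes X: "t0 \<in> X" "t1 \<in> X" "t0 < t1"
  shows "AE p in \<pi>. \<not> (fst p < t0 \<and> Tp t1 < snd p)"
proof -
  define d where "d = zpl - zmu"
  define l where "l = zpu - zml"
  have dl: "0 < d" "0 < l"
    using y T_Z(3)[of t0] Tm_range[of t0] Tp_range[of t0] by (auto simp: d_def l_def)
  show ?thesis
  proof (rule null_region[OF X, where e="\<lambda>\<phi> z. d / l / l * gap \<phi> (Tm t0) (Tp t1) z"])
    fix t \<phi> x z
    assume *: "t0 \<le> t" "t \<le> t1" "concave_on_triples Z \<phi>" "z \<in> Z"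
      "fst (x, z) < t0 \<and> Tp t1 < snd (x, z)"
    have "d / l / l * gap \<phi> (Tm t0) (Tp t1) z \<le> - excess \<phi> (Tm t) (Tp t) z"
      using * T_mono[of t0 t] T_mono[of t t1] T_Z[of t] T_Z[of t1] T_Z[of t0] Tp_range[of t] Tm_range[of t0] dl
      by (intro concave_on_triples.excess_right_bound[OF *(3)]) (auto simp: d_def l_def)
    then show "d / l / l * gap \<phi> (Tm t0) (Tp t1) z \<le> defect t \<phi> (x, z)"
      using * by (simp add: defect_def)
  next
    fix \<phi> x z
    assume *: "concave_on_triples Z \<phi>" "z \<in> Z" "fst (x, z) < t0 \<and> Tp t1 < snd (x, z)"
    then have "0 < gap \<phi> (Tm t0) (Tp t1) z"
      using T_Z[of t1] T_Z[of t0]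
      by (intro concave_on_triples.gap_pos[OF *(1)]) (auto simp del: Un_iff)
    then show "0 < d / l / l * gap \<phi> (Tm t0) (Tp t1) z"
      using dl by simp
  next
    fix \<phi> :: "real \<Rightarrow> real" assume "continuous_on Z \<phi>"
    then show "bounded_borel (\<lambda>z. d / l / l * gap \<phi> (Tm t0) (Tp t1) z)"
      unfolding gap_def by (intro bounded_borel_intros bounded_borel_continuous)
  qed (measurable, simp add: gap_add algebra_simps)
qed

text \<open>Each of the preceding null sets leaves a margin between \<open>t0\<close> and
  \<open>t1\<close>. Letting one of them be \<open>t\<close> and the other tend to it along a
  sequence covers every \<open>x\<close> other than \<open>t\<close> with countably many null
  sets.\<close>

lemma \<pi>_ordered:
  assumes t: "t \<in> X"
  shows "AE p in \<pi>. if t < fst p then snd p \<le> Tm t \<or> Tp t \<le> snd p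
    else fst p < t \<longrightarrow> Tm t \<le> snd p \<and> snd p \<le> Tp t"
proof -
  define h where "h n = inverse (real (Suc n))" for n
  have h: "0 < h n" for n by (simp add: h_def)
  have "AE p in \<pi>. \<forall>n. (t + h n \<in> X \<longrightarrow> \<not> (t + h n \<le> fst p \<and> Tm t < snd p \<and> snd p < Tp t)) \<and>
      (t - h n \<in> X \<longrightarrow> \<not> (fst p < t - h n \<and> snd p < Tm t) \<and> \<not> (fst p < t - h n \<and> Tp t < snd p))"
    unfolding AE_all_countable
    using null_inside[OF t, of "t + h _"] null_left[OF _ t, of "t - h _"] null_right[OF _ t, of "t - h _"] h
    by (simp add: AE_conj_iff AE_impI del: de_Morgan_conj)
  then show ?thesis
    using AE_space
  proof eventually_elim
    case (elim p)
    then have x: "fst p \<in> X" using plan_space[OF \<pi>] by auto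
    show ?case
    proof (cases "t < fst p")
      case True
      then obtain n where "h n < fst p - t"
        using reals_Archimedean[of "fst p - t"] by (auto simp: h_def)
      moreover have "t + h n \<in> X"
        using calculation x t h[of n] by auto
      ultimately show ?thesis using elim True by force
    next
      case False
      show ?thesis
      proof (cases "fst p < t")
        case True
        then obtain n where "h n < t - fst p"
          using reals_Archimedean[of "t - fst p"] by (auto simp: h_def)
        moreover have "t - h n \<in> X"
          using calculation x t h[of n] by auto
        ultimately show ?thesis using elim True by force
      qed (use False in auto)
    qed
  qed
qed

end

section \<open>Determination of a plan by its upper tails\<close>

context barycentric_problem
begin

lemma plan_fst_neq:
  assumes "\<pi> \<in> plans" "t \<in> X"
  shows "AE p in \<pi>. fst p \<noteq> t"
proof -
  have "AE x in M. x \<noteq> t"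
    using emeasure_singleton_M[OF assms(2)] assms(2)
    by (intro AE_I[of _ _ "{t}"]) (auto simp: sets_M sets_restrict_space_iff)
  then have "AE x in distr \<pi> M fst. x \<noteq> t"
    by (subst plan_fst[OF assms(1)])
  then show ?thesis
    by (rule AE_distrD[OF plan_measurable[OF assms(1) measurable_fst]])
qed

text \<open>For fixed \<open>B\<close> the tails give the distribution function of the finite
  measure \<open>\<mu> \<sigma> B\<close>, the first-coordinate law of \<open>\<sigma>\<close>
  restricted to \<open>z\<close> in \<open>B\<close>. This fixes the plan on rectangles, which
  generate the product and are stable under intersection.\<close>

lemma plan_eqI:
  assumes \<pi>: "\<pi> \<in> plans" and \<rho>: "\<rho> \<in> plans"
    and eq: "\<And>t B. t \<in> X \<Longrightarrow> B \<in> sets N \<Longrightarrow>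
      (\<integral>p. indicator {t..} (fst p) * indicator B (snd p) \<partial>\<pi>) =
      (\<integral>p. indicator {t..} (fst p) * indicator B (snd p) \<partial>\<rho> :: real)"
  shows "\<pi> = \<rho>"
proof -
  define \<mu> where "\<mu> \<sigma> B = distr (density \<sigma> (\<lambda>p. indicator B (snd p))) borel fst"
    for \<sigma> :: "(real \<times> real) measure" and B :: "real set"
  have em: "emeasure (\<mu> \<sigma> B) A = emeasure \<sigma> {p\<in>space \<sigma>. fst p \<in> A \<and> snd p \<in> B}"
    if \<sigma>: "\<sigma> \<in> plans" and [measurable]: "B \<in> sets N" "A \<in> sets borel" for \<sigma> A B
  proof -
    have [measurable]: "fst \<in> borel_measurable \<sigma>" "snd \<in> \<sigma> \<rightarrow>\<^sub>M N"
      by (auto intro: plan_measurable[OF \<sigma>])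
    have "emeasure (\<mu> \<sigma> B) A = emeasure (density \<sigma> (\<lambda>p. indicator B (snd p))) (fst -` A \<inter> space \<sigma>)"
      unfolding \<mu>_def by (subst emeasure_distr) auto
    also have "\<dots> = (\<integral>\<^sup>+p. indicator B (snd p) * indicator (fst -` A \<inter> space \<sigma>) p \<partial>\<sigma>)"
      by (rule emeasure_density) measurable
    also have "\<dots> = (\<integral>\<^sup>+p. indicator {p\<in>space \<sigma>. fst p \<in> A \<and> snd p \<in> B} p \<partial>\<sigma>)"
      by (intro nn_integral_cong) (auto simp: indicator_def)
    also have "\<dots> = emeasure \<sigma> {p\<in>space \<sigma>. fst p \<in> A \<and> snd p \<in> B}"
      by (rule nn_integral_indicator) measurable
    finally show ?thesis .
  qed
  have fin: "finite_borel_measure (\<mu> \<sigma> B)" if \<sigma>: "\<sigma> \<in> plans" and B: "B \<in> sets N" for \<sigma> B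
  proof -
    interpret prob_space \<sigma> by (rule plan_prob[OF \<sigma>])
    have "emeasure (\<mu> \<sigma> B) UNIV \<noteq> \<infinity>"
      using em[OF \<sigma> B, of UNIV] by simp
    then have "finite_measure (\<mu> \<sigma> B)"
      by (intro finite_measureI) (simp add: \<mu>_def)
    then show ?thesis
      by (simp add: finite_borel_measure_def finite_borel_measure_axioms_def \<mu>_def)
  qed
  \<comment> \<open>Inside \<open>X\<close> the sets \<open>{..x}\<close> and \<open>{x..}\<close>
    overlap only in a vertical line, which is null as \<open>M\<close> has no atoms; outside
    \<open>X\<close> the second marginal suffices.\<close>
  have cdf: "cdf (\<mu> \<sigma> B) x = (if x < xl then 0 else if x \<le> xu
      then (\<integral>z. indicator B z \<partial>N) - (\<integral>p. indicator {x..} (fst p) * indicator B (snd p) \<partial>\<sigma>)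
      else (\<integral>z. indicator B z \<partial>N))" if \<sigma>: "\<sigma> \<in> plans" and [measurable]: "B \<in> sets N" for \<sigma> B x
  proof -
    have [measurable]: "fst \<in> borel_measurable \<sigma>" "snd \<in> \<sigma> \<rightarrow>\<^sub>M N"
      by (auto intro: plan_measurable[OF \<sigma>])
    have sp: "fst p \<in> X" if "p \<in> space \<sigma>" for p
      using that plan_space[OF \<sigma>] by auto
    have B: "(\<integral>p. indicator B (snd p) \<partial>\<sigma> :: real) = (\<integral>z. indicator B z \<partial>N)"
      by (rule plan_integral_snd[OF \<sigma>]) measurable
    have "cdf (\<mu> \<sigma> B) x = measure \<sigma> {p\<in>space \<sigma>. fst p \<in> {..x} \<and> snd p \<in> B}"
      unfolding cdf_def measure_def by (subst em[OF \<sigma>]) auto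
    also have "\<dots> = (\<integral>p. indicator {p\<in>space \<sigma>. fst p \<in> {..x} \<and> snd p \<in> B} p \<partial>\<sigma>)"
      by (simp add: Int_absorb2)
    also have "\<dots> = (\<integral>p. indicator {..x} (fst p) * indicator B (snd p) \<partial>\<sigma>)"
      by (intro Bochner_Integration.integral_cong) (auto simp: indicator_def)
    finally have c: "cdf (\<mu> \<sigma> B) x = (\<integral>p. indicator {..x} (fst p) * indicator B (snd p) \<partial>\<sigma>)" .
    consider "x < xl" | "x \<in> X" | "xu < x" "xl \<le> x" by force
    then show ?thesis
    proof cases
      case 1
      have "(\<integral>p. indicator {..x} (fst p) * indicator B (snd p) \<partial>\<sigma>) = (\<integral>p. 0 \<partial>\<sigma> :: real)"
        by (intro Bochner_Integration.integral_cong) (use sp 1 in \<open>force simp: indicator_def\<close>)+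
      then show ?thesis using 1 c by simp
    next
      case 2
      have "(\<integral>p. indicator {..x} (fst p) * indicator B (snd p) \<partial>\<sigma>)
          = (\<integral>p. indicator B (snd p) - indicator {x..} (fst p) * indicator B (snd p) \<partial>\<sigma> :: real)"
        using plan_fst_neq[OF \<sigma> 2] by (intro integral_cong_AE) (auto elim!: eventually_mono simp: indicator_def)
      also have "\<dots> = (\<integral>p. indicator B (snd p) \<partial>\<sigma>) - (\<integral>p. indicator {x..} (fst p) * indicator B (snd p) \<partial>\<sigma>)"
        by (intro Bochner_Integration.integral_diff plan_integrable[OF \<sigma>, where C=1])
           (auto simp: indicator_def)
      finally show ?thesis using 2 c B by simp
    next
      case 3
      have "(\<integral>p. indicator {..x} (fst p) * indicator B (snd p) \<partial>\<sigma>) = (\<integral>p. indicator B (snd p) \<partial>\<sigma> :: real)"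
        by (intro Bochner_Integration.integral_cong) (use sp 3 in \<open>force simp: indicator_def\<close>)+
      then show ?thesis using 3 c B by simp
    qed
  qed
  have \<mu>_eq: "\<mu> \<pi> B = \<mu> \<rho> B" if B: "B \<in> sets N" for B
  proof (rule cdf_unique'[OF fin[OF \<pi> B] fin[OF \<rho> B]])
    show "cdf (\<mu> \<pi> B) = cdf (\<mu> \<rho> B)"
      using eq[OF _ B] by (auto simp: cdf[OF \<pi> B] cdf[OF \<rho> B] fun_eq_iff)
  qed
  have rect: "emeasure \<sigma> (A \<times> B) = emeasure (\<mu> \<sigma> B) A" if \<sigma>: "\<sigma> \<in> plans" and "A \<in> sets M" "B \<in> sets N" for \<sigma> A B
  proof -
    have "A \<in> sets borel" "A \<subseteq> X" "B \<subseteq> Z"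
      using that sets.sets_into_space[of B N] by (auto simp: sets_M sets_restrict_space_iff simp del: Un_iff)
    then show ?thesis
      using plan_space[OF \<sigma>] that by (subst em) (auto intro!: arg_cong[where f="emeasure \<sigma>"] simp del: Un_iff)
  qed
  show ?thesis
  proof (rule measure_eqI_generator_eq[OF Int_stable_pair_measure_generator[of M N]])
    show "{a \<times> b |a b. a \<in> sets M \<and> b \<in> sets N} \<subseteq> Pow (space M \<times> space N)"
      using sets.sets_into_space[of _ M] sets.sets_into_space[of _ N] by blast
    show "emeasure \<pi> S = emeasure \<rho> S" if "S \<in> {a \<times> b |a b. a \<in> sets M \<and> b \<in> sets N}" for S
      using that rect[OF \<pi>] rect[OF \<rho>] \<mu>_eq by auto
    show "sets \<pi> = sigma_sets (space M \<times> space N) {a \<times> b |a b. a \<in> sets M \<and> b \<in> sets N}"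
      by (simp only: plan_sets[OF \<pi>] sets_pair_measure)
    show "sets \<rho> = sigma_sets (space M \<times> space N) {a \<times> b |a b. a \<in> sets M \<and> b \<in> sets N}"
      by (simp only: plan_sets[OF \<rho>] sets_pair_measure)
    show "range (\<lambda>_::nat. space M \<times> space N) \<subseteq> {a \<times> b |a b. a \<in> sets M \<and> b \<in> sets N}" by blast
    show "(\<Union>i::nat. space M \<times> space N) = space M \<times> space N" by simp
    show "emeasure \<pi> (space M \<times> space N) \<noteq> \<infinity>"
      using prob_space.emeasure_space_1[OF plan_prob[OF \<pi>]] plan_space[OF \<pi>] by simp
  qed
qed

end

section \<open>Coincidence of the competing plan with the reference plan\<close>

context competing_plan
begin

lemma unique: "\<pi> = \<rho>"
proof (rule plan_eqI[OF \<pi> \<rho>])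
  fix t B assume t: "t \<in> X" and B: "B \<in> sets N"
  let ?h = "excess (indicator B) (Tm t) (Tp t)"
  have bounded_borel: "bounded_borel (indicator B)"
    unfolding bounded_borel_def using B by (auto intro!: exI[of _ 1] simp: indicator_def)
  then have h: "bounded_borel ?h" by (rule bounded_borel_excess)
  \<comment> \<open>The excess vanishes at \<open>Tm t\<close> and \<open>Tp t\<close>, and both
    plans obey the order at \<open>t\<close>. So its restriction to \<open>{x \<ge> t}\<close>
    agrees almost everywhere with this function of \<open>z\<close> alone, whose integral the second
    marginal determines. Subtracting the chord is how mass and mean settle the weights at the two
    endpoints.\<close>
  let ?k = "\<lambda>z. if z < Tm t \<or> Tp t < z then ?h z else 0"
  have [measurable]: "?h \<in> borel_measurable N" "?k \<in> borel_measurable N"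
    using bounded_borel_measurable[OF h] by measurable
  have *: "upper \<sigma> t ?h = (\<integral>z. ?k z \<partial>N)" if \<sigma>: "\<sigma> \<in> plans"
    and "AE p in \<sigma>. indicator {t..} (fst p) * ?h (snd p) = ?k (snd p)" for \<sigma>
  proof -
    have "upper \<sigma> t ?h = (\<integral>p. ?k (snd p) \<partial>\<sigma>)"
      unfolding upper_def using that by (intro integral_cong_AE) (auto intro!: plan_measurable[OF \<sigma>])
    also have "\<dots> = (\<integral>z. ?k z \<partial>N)"
      by (rule plan_integral_snd[OF \<sigma>]) measurable
    finally show ?thesis .
  qed
  have "AE p in \<rho>. indicator {t..} (fst p) * ?h (snd p) = ?k (snd p)"
    using \<rho>_ordered[of t] by eventually_elim (auto simp: indicator_def split: if_splits)
  moreover have "AE p in \<pi>. indicator {t..} (fst p) * ?h (snd p) = ?k (snd p)"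
    using \<pi>_ordered[OF t] plan_fst_neq[OF \<pi> t] by eventually_elim (auto simp: indicator_def split: if_splits)
  ultimately have "advantage \<pi> t ?h = 0"
    using *[OF \<pi>] *[OF \<rho>] by (simp add: advantage_def)
  then have "upper \<pi> t (indicator B) = upper \<rho> t (indicator B)"
    using advantage_excess[OF \<pi> bounded_borel T_Z(3), of t t] by (simp add: advantage_def)
  then show "(\<integral>p. indicator {t..} (fst p) * indicator B (snd p) \<partial>\<pi>) =
      (\<integral>p. indicator {t..} (fst p) * indicator B (snd p) \<partial>\<rho> :: real)"
    by (simp add: upper_def)
qed

end

theorem theorem3p6:
  fixes X Z :: "real set" and zml zmu zpl zpu y :: real
    and \<sigma>X \<sigma>Z :: "real measure" and c :: "real \<Rightarrow> real \<Rightarrow> real"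
  assumes "compact X" "is_interval X"
    and "zml \<le> zmu" "zpl \<le> zpu" "Z = {zml..zmu} \<union> {zpl..zpu}"
    and "\<sigma>X \<in> borel_probs X" "\<sigma>Z \<in> borel_probs Z"
    and "y = (\<integral>z. z \<partial>\<sigma>Z)" "zmu < y" "y < zpl"
    and "non_atomic \<sigma>X"
    and "continuous_on (X \<times> Z) (\<lambda>(x, z). c x z)"
    and "martingale_spence_mirrlees X Z c"
  shows "\<exists>!\<pi>. \<pi> \<in> bar_couplings (\<lambda>x. y) \<sigma>X \<sigma>Z \<and>
    (\<forall>\<pi>' \<in> bar_couplings (\<lambda>x. y) \<sigma>X \<sigma>Z.
       (\<integral>(x, z). c x z \<partial>\<pi>) \<le> (\<integral>(x, z). c x z \<partial>\<pi>'))"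
proof -
  obtain xl xu where X: "X = {xl..xu}"
    using assms(1,2) connected_compact_interval_1 is_interval_connected by metis
  interpret barycentric_problem xl xu zml zmu zpl zpu y \<sigma>X \<sigma>Z
    using assms unfolding X by unfold_locales simp_all
  obtain \<rho> Tm Tp where \<rho>: "\<rho> \<in> plans" and T: "antimono Tm" "mono Tp"
      "\<And>x. zml \<le> Tm x \<and> Tm x \<le> zmu" "\<And>x. zpl \<le> Tp x \<and> Tp x \<le> zpu"
      "AE p in \<rho>. snd p = Tm (fst p) \<or> snd p = Tp (fst p)"
    by (rule monotone_plan, rule that)
  interpret monotone_reference_cost xl xu zml zmu zpl zpu y \<sigma>X \<sigma>Z \<rho> Tm Tp c
    using \<rho> T assms(12,13) unfolding X assms(5) by unfold_locales
  show ?thesis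
  proof (rule ex1I[of _ \<rho>])
    show "\<rho> \<in> plans \<and> (\<forall>\<pi>'\<in>plans. (\<integral>(x, z). c x z \<partial>\<rho>) \<le> (\<integral>(x, z). c x z \<partial>\<pi>'))"
      using \<rho> reference_optimal by blast
  next
    fix \<pi> assume "\<pi> \<in> plans \<and> (\<forall>\<pi>'\<in>plans. (\<integral>(x, z). c x z \<partial>\<pi>) \<le> (\<integral>(x, z). c x z \<partial>\<pi>'))"
    then interpret competing_plan xl xu zml zmu zpl zpu y \<sigma>X \<sigma>Z \<rho> Tm Tp c \<pi>
      using \<rho> by unfold_locales auto
    show "\<pi> = \<rho>" by (rule unique)
  qed
qed

end
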